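(* Let $k$ and $n$ be positive integers. For $m\in\{0,1,2\}$, we have $$u_m(n)=\sum_{j=0}^{\infty}C_m\big(n+k(3k+1)/2-j\big)\,\big(M_k(j)+\widetilde{P}_k(j)\big).$$
   Context: Unimodal compositions. A composition of a positive integer $n$ is a sequence $(\lambda_1,\ldots,\lambda_r)$ of positive integers (parts) with sum $n$. It is unimodal if there exists $t\in\{1,\ldots,r\}$ with $\lambda_1\leqslant\cdots\leqslant\lambda_t$ and $\lambda_t\geqslant\cdots\geqslant\lambda_r$. For $n\geqslant 1$, $u_0(n)$ is the number of unimodal compositions of $n$. For $m\geqslant1$ and $n\geqslant0$, $u_m(n)$ is the number of unimodal compositions of $n+m$ in which the maximal part appears exactly $m$ times. Crank. For a partition $\lambda=(\lambda_1\geqslant\lambda_2\geqslant\cdots)$, let $\omega(\lambda)$ be the number of parts of $\lambda$ equal to $1$, and $\mu(\lambda)$ the number of parts of $\lambda$ larger than $\omega(\lambda)$. The crank is $c(\lambda)=\lambda_1$ (the largest part) if $\omega(\lambda)=0$, and $c(\lambda)=\mu(\lambda)-\omega(\lambda)$ if $\omega(\lambda)>0$. The empty partition of $0$ has crank $0$. For a non-negative integer $n\neq1$: $C_0(n)$ is the number of partitions $\lambda$ of $n$ with $c(\lambda)>0$; $C_1(n)$ is the number of partitions $\lambda$ of $n$ with $c(\lambda)\geqslant0$; $C_2(n)$ is the number of partitions $\lambda$ of $n$ with $c(\lambda)=0$. Thus $C_0(0)=0$ and $C_1(0)=C_2(0)=1$. Moreover, by definition, $C_0(1)=1$, $C_1(1)=0$,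 $C_2(1)=-1$. Convention: $C_m(n)=0$ for $n<0$ (so the sum over $j$ is finite). $M_k(n)$ (for $k\geqslant 1$, $n\geqslant 0$) is the number of partitions of $n$ in which $k$ is the least positive integer that is not a part and there are more parts $>k$ than there are parts $<k$ (parts counted with multiplicity); in particular $M_k(0)=0$. $\widetilde{P}_k(n)$ (for $k\geqslant 1$, $n\geqslant 0$) is the number of partitions of $n$ in which every integer $1,2,\ldots,k$ appears as a part at least once, and the first part larger than $k$ (i.e. the smallest part among the parts exceeding $k$, which is required to exist) appears at least $k+1$ times; in particular $\widetilde{P}_k(0)=0$. *)

theory Defs
  imports Complex_Main "HOL-Library.Multiset"
begin

definition is_composition :: "nat \<Rightarrow> nat list \<Rightarrow> bool" where
  "is_composition n xs \<longleftrightarrow> (\<forall>x\<in>set xs. 0 < x) \<and> sum_list xs = n"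

(* The parts at (one-based) positions 1..t increase weakly, those at positions t..r decrease weakly. *)
definition unimodal :: "nat list \<Rightarrow> bool" where
  "unimodal xs \<longleftrightarrow>
     (\<exists>t\<in>{1..length xs}. sorted_wrt (\<le>) (take t xs) \<and> sorted_wrt (\<ge>) (drop (t - 1) xs))"

(* The case m = 0 is separate: there the multiplicity of the maximal part is unrestricted. *)
definition u :: "nat \<Rightarrow> nat \<Rightarrow> nat" where
  "u m n =
     (if m = 0 then card {xs. is_composition n xs \<and> unimodal xs}
      else card {xs. is_composition (n + m) xs \<and> unimodal xs \<and> count_list xs (Max (set xs)) = m})"

(* A partition is the multiset of its parts. *)
definition is_partition :: "nat \<Rightarrow> nat multiset \<Rightarrow> bool" where
  "is_partition n L \<longleftrightarrow> 0 \<notin># L \<and> sum_mset L = n"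

definition crank :: "nat multiset \<Rightarrow> int" where
  "crank L =
     (let w = count L 1 in
      if L = {#} then 0
      else if w = 0 then int (Max (set_mset L))
      else int (size {#p \<in># L. w < p#}) - int w)"

(* The values at 1 are conventions and differ from the literal counts: the crank of {#1#} is -1. *)
definition C0 :: "int \<Rightarrow> int" where
  "C0 N = (if N < 0 then 0 else if N = 1 then 1
           else int (card {L. is_partition (nat N) L \<and> crank L > 0}))"

definition C1 :: "int \<Rightarrow> int" where
  "C1 N = (if N < 0 then 0 else if N = 1 then 0
           else int (card {L. is_partition (nat N) L \<and> crank L \<ge> 0}))"

definition C2 :: "int \<Rightarrow> int" where
  "C2 N = (if N < 0 then 0 else if N = 1 then -1
           else int (card {L. is_partition (nat N) L \<and> crank L = 0}))"

(* Only the indices m = 0, 1, 2 are meaningful. *)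
definition C :: "nat \<Rightarrow> int \<Rightarrow> int" where
  "C m = (if m = 0 then C0 else if m = 1 then C1 else C2)"

definition M :: "nat \<Rightarrow> nat \<Rightarrow> nat" where
  "M k n = card {L. is_partition n L \<and> k = (LEAST i. 0 < i \<and> i \<notin># L) \<and>
                    size {#p \<in># L. p < k#} < size {#p \<in># L. k < p#}}"

definition P_tilde :: "nat \<Rightarrow> nat \<Rightarrow> nat" where
  "P_tilde k n = card {L. is_partition n L \<and> (\<forall>i\<in>{1..k}. i \<in># L) \<and>
                          {p \<in> set_mset L. k < p} \<noteq> {} \<and>
                          k + 1 \<le> count L (Min {p \<in> set_mset L. k < p})}"

end

(* With P = 1/(q;q)_inf and e_i = 1/(q;q)_i, all three identities come from one double sum.
   Let R_m be the set of positive (m = 0), nonnegative (m = 1) or zero (m = 2) integers.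

   Sorting unimodal compositions by their maximal part, and partitions by their number w of
   ones and their number i of parts larger than w, gives for all relevant indices
     sum_n u_m(n) q^n = sum_{a - b in R_m} q^(a + b) e_a e_b,
     sum_n C_m(n) q^n = (1 - q) sum_{i - w in R_m} q^(i + w + i w) e_i e_w,
   where the values prescribed for C_m(1) are exactly what makes the second formula hold at n = 1.
   Since e_a e_b = sum_t q^((a - t)(b - t)) e_t e_{a - t} e_{b - t}, and passing from (a, b) to
   (a - t, b - t) preserves the condition on the difference, the first sum is the double sum of
   the second one times sum_t q^(2 t) e_t = (1 - q) P. Hence u_m is the convolution of C_m with
   the partition function p.

   It remains to see that M_k(j) + P~_k(j) = p(j - K) with K = k (3 k + 1)/2. This holds already
   after fixing the number k + s of parts larger than k: both sides then have the generating
   function q^K q^((k + 1) s) e_k e_s. *)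
theory Submission
  imports Defs "HOL-Computational_Algebra.Formal_Power_Series"
begin

unbundle fps_syntax

subsection \<open>Generating functions of weighted sets\<close>

text \<open>Finiteness of every weight class is required because \<open>card\<close> of an infinite
  set is 0, so that a coefficient could otherwise fail to count.\<close>

definition has_gf :: "('a \<Rightarrow> nat) \<Rightarrow> 'a set \<Rightarrow> int fps \<Rightarrow> bool" where
  "has_gf s A f \<longleftrightarrow> (\<forall>n. finite {x \<in> A. s x = n} \<and> int (card {x \<in> A. s x = n}) = f $ n)"

lemma has_gf_unique: "has_gf s A f \<Longrightarrow> has_gf s A g \<Longrightarrow> f = g"
  by (auto simp: has_gf_def fps_eq_iff)

lemma has_gfI:
  assumes "\<And>n. finite {x \<in> A. s x = n}"
  shows "has_gf s A (Abs_fps (\<lambda>n. int (card {x \<in> A. s x = n})))"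
  using assms by (simp add: has_gf_def)

text \<open>Supplies an unnamed series, which later arguments pin down by an equation that it
  satisfies.\<close>

lemma has_gf_subset:
  assumes "has_gf s A f" "B \<subseteq> A"
  shows "\<exists>g. has_gf s B g"
proof -
  have "finite {x \<in> B. s x = n}" for n
    by (rule finite_subset[of _ "{x \<in> A. s x = n}"]) (use assms in \<open>auto simp: has_gf_def\<close>)
  thus ?thesis using has_gfI by blast
qed

lemma has_gf_disj_Un:
  assumes "has_gf s A f" "has_gf s B g" "A \<inter> B = {}"
  shows "has_gf s (A \<union> B) (f + g)"
proof -
  have eq: "{x \<in> A \<union> B. s x = n} = {x \<in> A. s x = n} \<union> {x \<in> B. s x = n}" for n by auto
  have "card ({x \<in> A. s x = n} \<union> {x \<in> B. s x = n}) = card {x \<in> A. s x = n} + card {x \<in> B. s x = n}" for n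
    by (rule card_Un_disjoint) (use assms in \<open>auto simp: has_gf_def\<close>)
  with assms show ?thesis unfolding has_gf_def eq by simp
qed

lemma has_gf_singleton: "has_gf s {x} (fps_X ^ s x)"
proof -
  have "{y \<in> {x}. s y = n} = (if n = s x then {x} else {})" for n by auto
  thus ?thesis by (simp add: has_gf_def fps_X_power_nth)
qed

text \<open>The gain \<open>c\<close> is the weight of the forced parts, or of the shift of parts,
  that \<open>h\<close> puts into every object alike; it becomes a monomial factor.\<close>

lemma has_gf_bij:
  assumes f: "has_gf s A f" and bij: "bij_betw h A B" and sh: "\<And>x. x \<in> A \<Longrightarrow> t (h x) = s x + c"
  shows "has_gf t B (fps_X ^ c * f)"
proof -
  have img: "{y \<in> B. t y = n} = h ` {x \<in> A. s x + c = n}" for n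
    using bij sh by (auto simp: bij_betw_def)
  have inj: "inj_on h {x \<in> A. s x + c = n}" for n
    using bij by (auto simp: bij_betw_def intro: inj_on_subset)
  have fib: "{x \<in> A. s x + c = n} = (if n < c then {} else {x \<in> A. s x = n - c})" for n by auto
  show ?thesis
    unfolding has_gf_def img card_image[OF inj]
    using f by (auto simp: fib has_gf_def fps_X_power_mult_nth)
qed

lemma has_gf_bij0:
  assumes "has_gf s A f" "bij_betw h A B" "\<And>x. x \<in> A \<Longrightarrow> t (h x) = s x"
  shows "has_gf t B f"
  using has_gf_bij[of s A f h B t 0] assms by simp

lemma has_gf_prod:
  assumes "has_gf s A f" "has_gf t B g"
  shows "has_gf (\<lambda>(x, y). s x + t y) (A \<times> B) (f * g)"
  unfolding has_gf_def
proof (intro allI conjI)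
  fix n
  have eq: "{z \<in> A \<times> B. (case z of (x, y) \<Rightarrow> s x + t y) = n} =
      (\<Union>i\<in>{0..n}. {x \<in> A. s x = i} \<times> {y \<in> B. t y = n - i})" by auto
  have fin: "finite ({x \<in> A. s x = i} \<times> {y \<in> B. t y = j})" for i j
    using assms by (auto simp: has_gf_def)
  show "finite {z \<in> A \<times> B. (case z of (x, y) \<Rightarrow> s x + t y) = n}"
    unfolding eq using fin by blast
  have "card (\<Union>i\<in>{0..n}. {x \<in> A. s x = i} \<times> {y \<in> B. t y = n - i}) =
      (\<Sum>i\<in>{0..n}. card ({x \<in> A. s x = i} \<times> {y \<in> B. t y = n - i}))"
    by (rule card_UN_disjoint) (use fin in auto)
  thus "int (card {z \<in> A \<times> B. (case z of (x, y) \<Rightarrow> s x + t y) = n}) = (f * g) $ n"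
    unfolding eq using assms by (simp add: fps_mult_nth card_cartesian_product has_gf_def)
qed

text \<open>Stated for one coefficient at a time: a statistic \<open>g\<close> may take infinitely
  many values on \<open>A\<close>, but takes only finitely many on the objects of weight
  \<open>n\<close>. This avoids infinite sums of series.\<close>

lemma has_gf_fibre:
  assumes "\<And>i. i \<in> I \<Longrightarrow> has_gf s {x \<in> A. g x = i} (f i)"
    and "\<And>x. x \<in> A \<Longrightarrow> s x = n \<Longrightarrow> g x \<in> I" and "finite I"
  shows "int (card {x \<in> A. s x = n}) = (\<Sum>i\<in>I. f i $ n)"
proof -
  have eq: "{x \<in> A. s x = n} = (\<Union>i\<in>I. {x \<in> {x \<in> A. g x = i}. s x = n})"
    using assms(2) by auto
  have "card (\<Union>i\<in>I. {x \<in> {x \<in> A. g x = i}. s x = n}) = (\<Sum>i\<in>I. card {x \<in> {x \<in> A. g x = i}. s x = n})"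
    by (rule card_UN_disjoint) (use assms in \<open>auto simp: has_gf_def\<close>)
  thus ?thesis unfolding eq using assms(1) by (simp add: has_gf_def)
qed

section \<open>Partitions with parts in a prescribed set\<close>

abbreviation parts_in :: "nat set \<Rightarrow> nat multiset set" where
  "parts_in S \<equiv> {L. set_mset L \<subseteq> S}"

text \<open>A multiset is the sum of its restrictions to \<open>S\<close> and \<open>T\<close>, and
  these can be chosen independently. Every later cut of a partition at a given part size goes
  through this.\<close>

lemma has_gf_split:
  assumes X: "has_gf sum_mset A f" and Y: "has_gf sum_mset B g"
    and A: "A \<subseteq> parts_in S" and B: "B \<subseteq> parts_in T" and ST: "S \<inter> T = {}"
  shows "has_gf sum_mset {L. set_mset L \<subseteq> S \<union> T \<and> filter_mset (\<lambda>p. p \<in> S) L \<in> A \<and> filter_mset (\<lambda>p. p \<in> T) L \<in> B} (f * g)"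
    (is "has_gf _ ?Z _")
proof (rule has_gf_bij0[OF has_gf_prod[OF X Y]])
  have f1: "filter_mset (\<lambda>p. p \<in> S) (a + b) = a" "filter_mset (\<lambda>p. p \<in> T) (a + b) = b"
    if "a \<in> A" "b \<in> B" for a b
  proof -
    have "set_mset a \<subseteq> S" "set_mset b \<subseteq> T" using that A B by auto
    hence "count a x = 0 \<or> x \<in> S" "count b x = 0 \<or> x \<in> T" for x
      by (auto simp flip: not_in_iff)
    with ST show "filter_mset (\<lambda>p. p \<in> S) (a + b) = a" "filter_mset (\<lambda>p. p \<in> T) (a + b) = b"
      by (auto simp: multiset_eq_iff disjoint_iff)
  qed
  have f2: "filter_mset (\<lambda>p. p \<in> S) L + filter_mset (\<lambda>p. p \<in> T) L = L" if "set_mset L \<subseteq> S \<union> T" for L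
  proof (rule multiset_eqI)
    fix x
    have "count L x = 0 \<or> x \<in> S \<union> T" using that by (auto simp flip: not_in_iff)
    with ST show "count (filter_mset (\<lambda>p. p \<in> S) L + filter_mset (\<lambda>p. p \<in> T) L) x = count L x"
      by auto
  qed
  show "bij_betw (\<lambda>(a, b). a + b) (A \<times> B) ?Z"
    by (rule bij_betw_byWitness[where f' = "\<lambda>L. (filter_mset (\<lambda>p. p \<in> S) L, filter_mset (\<lambda>p. p \<in> T) L)"])
      (use f1 f2 A B in \<open>auto simp: subset_iff\<close>)
qed auto

lemma finite_multisets_size: "finite {L. set_mset L \<subseteq> {..n::nat} \<and> size L = s}"
proof -
  have "{L. set_mset L \<subseteq> {..n} \<and> size L = s} \<subseteq> mset ` {xs. set xs \<subseteq> {..n} \<and> length xs = s}"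
  proof
    fix L assume L: "L \<in> {L. set_mset L \<subseteq> {..n} \<and> size L = s}"
    obtain xs where "L = mset xs" using ex_mset by metis
    thus "L \<in> mset ` {xs. set xs \<subseteq> {..n} \<and> length xs = s}" using L by auto
  qed
  thus ?thesis by (rule finite_subset) (auto intro: finite_lists_length_eq)
qed

lemma le_sum_mset: "p \<in># L \<Longrightarrow> p \<le> sum_mset (L :: nat multiset)"
  by (induction L) auto

lemma size_le_sum_mset: "0 \<notin># L \<Longrightarrow> size L \<le> sum_mset (L :: nat multiset)"
  by (induction L) auto

text \<open>For finite \<open>S\<close> without 0 this is the product of
  \<open>1 / (1 - X^s)\<close> over \<open>s\<close> in \<open>S\<close>. Counting instead of
  inverting keeps the identities free of division: factors \<open>1 - X^i\<close> are multiplied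
  across and cancelled at the end.\<close>

definition parts_gf :: "nat set \<Rightarrow> int fps" where
  "parts_gf S = Abs_fps (\<lambda>n. int (card {L \<in> parts_in S. sum_mset L = n}))"

lemma has_gf_parts_gf: assumes "0 \<notin> S" shows "has_gf sum_mset (parts_in S) (parts_gf S)"
  unfolding parts_gf_def
proof (rule has_gfI)
  fix n
  have "{L \<in> parts_in S. sum_mset L = n} \<subseteq> (\<Union>s\<in>{..n}. {L. set_mset L \<subseteq> {..n} \<and> size L = s})"
  proof
    fix L assume L: "L \<in> {L \<in> parts_in S. sum_mset L = n}"
    hence "0 \<notin># L" using assms by auto
    with L size_le_sum_mset le_sum_mset show "L \<in> (\<Union>s\<in>{..n}. {L. set_mset L \<subseteq> {..n} \<and> size L = s})"
      by (auto simp: subset_iff)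
  qed
  thus "finite {L \<in> parts_in S. sum_mset L = n}"
    by (rule finite_subset) (auto simp: finite_multisets_size)
qed

lemma parts_gf_empty: "parts_gf {} = 1"
  by (rule has_gf_unique[OF has_gf_parts_gf]) (use has_gf_singleton[of sum_mset "{#}"] in auto)

lemma has_gf_parts_gf_contains:
  assumes "x \<in> S" "0 \<notin> S"
  shows "has_gf sum_mset {L \<in> parts_in S. x \<in># L} (fps_X ^ x * parts_gf S)"
  by (rule has_gf_bij[OF has_gf_parts_gf[OF assms(2)], of "add_mset x"],
      rule bij_betw_byWitness[where f' = "\<lambda>L. L - {#x#}"])
    (use assms in \<open>auto dest: in_diffD\<close>)

text \<open>The partitions that contain \<open>x\<close> arise from arbitrary ones by adding one
  copy of \<open>x\<close>, which gives a geometric equation for the series.\<close>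

lemma parts_gf_insert:
  assumes "x \<notin> S" "0 \<notin> S" "0 < x"
  shows "parts_gf (insert x S) * (1 - fps_X ^ x) = parts_gf S"
proof -
  have "has_gf sum_mset (parts_in S \<union> {L \<in> parts_in (insert x S). x \<in># L}) (parts_gf S + fps_X ^ x * parts_gf (insert x S))"
    by (intro has_gf_disj_Un has_gf_parts_gf has_gf_parts_gf_contains) (use assms in auto)
  moreover have "parts_in S \<union> {L \<in> parts_in (insert x S). x \<in># L} = parts_in (insert x S)" by auto
  ultimately have "parts_gf S + fps_X ^ x * parts_gf (insert x S) = parts_gf (insert x S)"
    using has_gf_parts_gf[of "insert x S"] assms by (auto intro: has_gf_unique)
  thus ?thesis by (simp add: algebra_simps)
qed

abbreviation upto_gf :: "nat \<Rightarrow> int fps" where "upto_gf i \<equiv> parts_gf {1..i}"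

lemma upto_gf_0: "upto_gf 0 = 1" by (simp add: parts_gf_empty)

lemma upto_gf_Suc: "upto_gf (Suc i) * (1 - fps_X ^ Suc i) = upto_gf i"
  using parts_gf_insert[of "Suc i" "{1..i}"] by (simp add: atLeastAtMostSuc_conv)

lemma one_minus_X_nz: "0 < i \<Longrightarrow> 1 - fps_X ^ i \<noteq> (0 :: int fps)"
proof
  assume "0 < i" "1 - fps_X ^ i = (0 :: int fps)"
  hence "(1 - fps_X ^ i :: int fps) $ 0 = 0 $ 0" by simp
  thus False using \<open>0 < i\<close> by (simp add: fps_X_power_nth)
qed

lemma sum_mset_Suc: "sum_mset (image_mset Suc L) = sum_mset L + size L"
  by (induction L) auto

text \<open>With zeros allowed, multisets of size \<open>s\<close> are partitions into at most
  \<open>s\<close> parts, so the claim amounts to conjugation. It is proved by recursion instead: a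
  multiset of size \<open>s + 1\<close> either contains a 0, which can be removed, or can be lowered
  by 1 throughout.\<close>

lemma has_gf_size: "has_gf sum_mset {L. size L = s} (upto_gf s)"
proof (induction s)
  case 0
  have "{L :: nat multiset. size L = 0} = {{#}}" by simp
  moreover have "has_gf sum_mset {{#}} (upto_gf 0)"
    using has_gf_singleton[of sum_mset "{#}"] unfolding upto_gf_0 by simp
  ultimately show ?case by (simp only:)
next
  case (Suc s)
  have fin: "finite {L \<in> {L. size L = Suc s}. sum_mset L = n}" for n :: nat
    by (rule finite_subset[OF _ finite_multisets_size[of n "Suc s"]]) (auto dest: le_sum_mset)
  define h where "h = Abs_fps (\<lambda>n. int (card {L \<in> {L :: nat multiset. size L = Suc s}. sum_mset L = n}))"
  have h: "has_gf sum_mset {L :: nat multiset. size L = Suc s} h"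
    unfolding h_def by (rule has_gfI) (rule fin)
  have 1: "has_gf sum_mset {L. size L = Suc s \<and> 0 \<in># L} (upto_gf s)"
    by (rule has_gf_bij0[OF Suc, of "add_mset 0"],
        rule bij_betw_byWitness[where f' = "\<lambda>L. L - {#0#}"]) (auto simp: size_Diff_singleton)
  have inv: "image_mset (\<lambda>x. x - Suc 0) (image_mset Suc L) = L" for L
    by (simp add: multiset.map_comp o_def)
  have inv2: "image_mset Suc (image_mset (\<lambda>x. x - Suc 0) L) = L" if "0 \<notin># L" for L
    using that by (induction L) auto
  have 2: "has_gf sum_mset {L. size L = Suc s \<and> 0 \<notin># L} (fps_X ^ Suc s * h)"
    by (rule has_gf_bij[OF h, of "image_mset Suc"],
        rule bij_betw_byWitness[where f' = "image_mset (\<lambda>x. x - 1)"])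
      (auto simp: inv inv2 sum_mset_Suc)
  have "{L :: nat multiset. size L = Suc s} = {L. size L = Suc s \<and> 0 \<in># L} \<union> {L. size L = Suc s \<and> 0 \<notin># L}"
    by auto
  hence "has_gf sum_mset {L :: nat multiset. size L = Suc s} (upto_gf s + fps_X ^ Suc s * h)"
    using has_gf_disj_Un[OF 1 2] by (auto simp: disjoint_iff)
  hence "h = upto_gf s + fps_X ^ Suc s * h" using h has_gf_unique by blast
  hence "h * (1 - fps_X ^ Suc s) = upto_gf (Suc s) * (1 - fps_X ^ Suc s)"
    unfolding upto_gf_Suc by (simp add: algebra_simps)
  hence "h = upto_gf (Suc s)" using one_minus_X_nz[of "Suc s"] by simp
  with h show ?case by simp
qed

subsection \<open>Multisets with restrictions on the size\<close>

lemma has_gf_empty: "has_gf s {} 0"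
  by (simp add: has_gf_def)

lemma has_gf_shift:
  fixes m :: nat
  assumes "has_gf sum_mset A f" "A \<subseteq> {L. size L = b}"
  shows "has_gf sum_mset (image_mset ((+) m) ` A) (fps_X ^ (m * b) * f)"
proof (rule has_gf_bij[OF assms(1)])
  show "bij_betw (image_mset ((+) m)) A (image_mset ((+) m) ` A)"
    by (rule inj_on_imp_bij_betw) (auto intro: inj_on_subset[OF multiset.inj_map])
next
  fix L assume "L \<in> A"
  hence "size L = b" using assms(2) by auto
  moreover have "sum_mset (image_mset ((+) m) L) = sum_mset L + m * size L" by (induction L) auto
  ultimately show "sum_mset (image_mset ((+) m) L) = sum_mset L + m * b" by simp
qed

lemma image_mset_shift_ex:
  assumes "\<And>p. p \<in># L \<Longrightarrow> m \<le> (p :: nat)"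
  obtains L' where "L = image_mset ((+) m) L'"
proof
  show "L = image_mset ((+) m) (image_mset (\<lambda>x. x - m) L)"
    using assms by (induction L) auto
qed

lemma has_gf_size_ge: "has_gf sum_mset {L. size L = b \<and> set_mset L \<subseteq> {m..}} (fps_X ^ (m * b) * upto_gf b)"
proof -
  have "image_mset ((+) m) ` {L. size L = b} = {L. size L = b \<and> set_mset L \<subseteq> {m..}}"
    by (auto simp: subset_iff intro: image_mset_shift_ex[of _ m])
  thus ?thesis using has_gf_shift[OF has_gf_size[of b], of b m] by simp
qed

text \<open>The Gaussian binomial coefficient, with the denominator moved to the other side.\<close>

lemma q_binomial:
  "has_gf sum_mset {L \<in> parts_in {1..k}. size L \<le> N} f \<Longrightarrow> f * upto_gf (N + k) = upto_gf k * upto_gf N"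
proof (induction N arbitrary: k f)
  case 0
  have "{L \<in> parts_in {1..k}. size L \<le> 0} = {{#}}" by auto
  hence "f = 1" using 0 has_gf_unique[OF has_gf_singleton[of sum_mset "{#}"]] by fastforce
  thus ?case by (simp add: parts_gf_empty)
next
  case (Suc N)
  show ?case using Suc.prems
  proof (induction k arbitrary: f)
    case 0
    have "{L \<in> parts_in {1..0}. size L \<le> Suc N} = {{#}}" by auto
    hence "f = 1" using 0 has_gf_unique[OF has_gf_singleton[of sum_mset "{#}"]] by fastforce
    thus ?case by (simp add: parts_gf_empty)
  next
    case (Suc k)
    \<comment> \<open>The q-Pascal rule: \<open>g\<close> belongs to the partitions without a part
      \<open>k + 1\<close>, and \<open>h\<close> to what remains of the others after one such part
      is removed. The inner induction hypothesis applies to \<open>g\<close>, the outer one to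
      \<open>h\<close>.\<close>
    obtain g where g: "has_gf sum_mset {L \<in> parts_in {1..k}. size L \<le> Suc N} g"
      using has_gf_subset[OF has_gf_parts_gf[of "{1..k}"]] by (metis (no_types, lifting) atLeastAtMost_iff not_one_le_zero mem_Collect_eq subsetI)
    obtain h where h: "has_gf sum_mset {L \<in> parts_in {1..Suc k}. size L \<le> N} h"
      using has_gf_subset[OF has_gf_parts_gf[of "{1..Suc k}"]] by (metis (no_types, lifting) atLeastAtMost_iff not_one_le_zero mem_Collect_eq subsetI)
    have "has_gf sum_mset {L \<in> parts_in {1..Suc k}. size L \<le> Suc N \<and> Suc k \<in># L} (fps_X ^ Suc k * h)"
      by (rule has_gf_bij[OF h, of "add_mset (Suc k)"],
          rule bij_betw_byWitness[where f' = "\<lambda>L. L - {#Suc k#}"])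
        (auto dest: in_diffD simp: size_Diff_singleton)
    moreover have "{L \<in> parts_in {1..k}. size L \<le> Suc N} \<inter>
        {L \<in> parts_in {1..Suc k}. size L \<le> Suc N \<and> Suc k \<in># L} = {}"
      by (auto simp: subset_iff)
    ultimately have "has_gf sum_mset ({L \<in> parts_in {1..k}. size L \<le> Suc N} \<union>
        {L \<in> parts_in {1..Suc k}. size L \<le> Suc N \<and> Suc k \<in># L}) (g + fps_X ^ Suc k * h)"
      by (rule has_gf_disj_Un[OF g])
    also have "{L \<in> parts_in {1..k}. size L \<le> Suc N} \<union>
        {L \<in> parts_in {1..Suc k}. size L \<le> Suc N \<and> Suc k \<in># L} = {L \<in> parts_in {1..Suc k}. size L \<le> Suc N}"
      by (auto simp: atLeastAtMostSuc_conv)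
    finally have f: "f = g + fps_X ^ Suc k * h"
      using Suc.prems has_gf_unique by blast
    have gD: "g * upto_gf (Suc (N + k)) = upto_gf k * upto_gf (Suc N)" using Suc.IH[OF g] by simp
    have hD: "h * upto_gf (Suc (N + k)) = upto_gf (Suc k) * upto_gf N" using Suc.prems \<open>\<And>k f. _ \<Longrightarrow> f * upto_gf (N + k) = upto_gf k * upto_gf N\<close>[OF h] by simp
    have "f * upto_gf (Suc N + Suc k) * (1 - fps_X ^ (Suc N + Suc k)) = f * upto_gf (Suc (N + k))"
      using upto_gf_Suc[of "Suc (N + k)"] by (simp add: mult.assoc)
    also have "\<dots> = upto_gf k * upto_gf (Suc N) + fps_X ^ Suc k * (upto_gf (Suc k) * upto_gf N)"
      unfolding f by (simp only: distrib_right mult.assoc gD hD)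
    also have "\<dots> = upto_gf (Suc k) * upto_gf (Suc N) * (1 - fps_X ^ (Suc N + Suc k))"
      unfolding upto_gf_Suc[of k, symmetric] upto_gf_Suc[of N, symmetric] power_add by algebra
    finally show ?case using one_minus_X_nz[of "Suc N + Suc k"] by simp
  qed
qed

lemma zero_notin_iff: "0 \<notin># L \<longleftrightarrow> set_mset L \<subseteq> {1::nat..}"
proof
  assume "0 \<notin># L"
  hence "x \<noteq> 0" if "x \<in># L" for x using that by metis
  thus "set_mset L \<subseteq> {1..}" by (auto simp: Suc_le_eq)
qed auto

section \<open>Multisets whose least element is repeated\<close>

lemma count_Min_shift:
  fixes L :: "nat multiset"
  assumes "L \<noteq> {#}"
  shows "count (image_mset ((+) m) L) (Min (set_mset (image_mset ((+) m) L))) = count L (Min (set_mset L))"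
proof -
  have "Min ((+) m ` set_mset L) = m + Min (set_mset L)"
    using assms by (subst mono_Min_commute) (auto simp: mono_def)
  moreover have "count (image_mset ((+) m) L) (m + x) = count L x" for x
    by (induction L) auto
  ultimately show ?thesis by simp
qed

lemma shift_min_count_image:
  assumes "0 < b"
  shows "image_mset ((+) m) ` {L :: nat multiset. size L = b \<and> c \<le> count L (Min (set_mset L))} =
    {L. size L = b \<and> c \<le> count L (Min (set_mset L)) \<and> set_mset L \<subseteq> {m..}}" (is "?l = ?r")
proof (intro equalityI subsetI)
  fix L assume "L \<in> ?l"
  then obtain L' where L': "L = image_mset ((+) m) L'" "size L' = b" "c \<le> count L' (Min (set_mset L'))"
    by blast
  hence "L' \<noteq> {#}" using assms by auto
  from count_Min_shift[OF this, of m] L' show "L \<in> ?r" by auto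
next
  fix L assume L: "L \<in> ?r"
  obtain L' where L': "L = image_mset ((+) m) L'"
    using L by (auto intro: image_mset_shift_ex[of L m])
  have "size L' = b" using L L' by simp
  moreover from this have "L' \<noteq> {#}" using assms by auto
  from count_Min_shift[OF this, of m] L L' have "c \<le> count L' (Min (set_mset L'))" by simp
  ultimately show "L \<in> ?l" using L' by blast
qed

text \<open>If the minimum is 0, removing \<open>c\<close> zeros leaves an arbitrary multiset of
  size \<open>b - c\<close>. Otherwise all \<open>b\<close> elements can be lowered by 1, which
  keeps the multiplicity of the minimum. Hence \<open>f = g + fps_X ^ b * f\<close>.\<close>

lemma min_count_gf:
  assumes f: "has_gf sum_mset {L :: nat multiset. size L = b \<and> c \<le> count L (Min (set_mset L))} f"
    and b: "0 < b" and c: "0 < c"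
  shows "f * (1 - fps_X ^ b) = (if c \<le> b then upto_gf (b - c) else 0)"
proof -
  define g where "g = (if c \<le> b then upto_gf (b - c) else 0)"
  let ?All = "{L :: nat multiset. size L = b \<and> c \<le> count L (Min (set_mset L))}"
  let ?Zero = "{L :: nat multiset. size L = b \<and> c \<le> count L 0}"
  let ?Pos = "{L :: nat multiset. size L = b \<and> c \<le> count L (Min (set_mset L)) \<and> set_mset L \<subseteq> {1..}}"
  have 1: "has_gf sum_mset ?Zero g"
  proof (cases "c \<le> b")
    case True
    have "bij_betw (\<lambda>L. L + replicate_mset c 0) {L. size L = b - c} ?Zero"
      by (rule bij_betw_byWitness[where f' = "\<lambda>L. L - replicate_mset c 0"])
        (use True in \<open>auto simp: size_Diff_submset count_le_replicate_mset_subset_eq\<close>)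
    from has_gf_bij0[OF has_gf_size this, of sum_mset] True show ?thesis by (simp add: g_def)
  next
    case False
    have "\<not> c \<le> count L 0" if "size L = b" for L :: "nat multiset"
      using False that count_le_size[of L 0] by linarith
    hence "?Zero = {}" by blast
    thus ?thesis using False has_gf_empty by (simp add: g_def del: Collect_empty_eq)
  qed
  have 2: "has_gf sum_mset ?Pos (fps_X ^ b * f)"
    using has_gf_shift[OF f, of b 1] unfolding shift_min_count_image[OF b] by auto
  have disj: "?Zero \<inter> ?Pos = {}"
    using c unfolding zero_notin_iff[symmetric] by (auto simp: not_in_iff)
  have S: "?Zero \<union> ?Pos = ?All"
  proof -
    have "Min (set_mset L) = 0" if "0 \<in># L" for L :: "nat multiset"
      using that by (metis Min_le finite_set_mset le_zero_eq)
    moreover have "0 \<in># L" if "c \<le> count L 0" for L :: "nat multiset"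
      using that c by (metis not_in_iff not_le)
    ultimately show ?thesis unfolding zero_notin_iff[symmetric] by fastforce
  qed
  from has_gf_disj_Un[OF 1 2 disj, unfolded S] have "f = g + fps_X ^ b * f"
    by (rule has_gf_unique[OF f])
  thus ?thesis unfolding g_def by (simp add: algebra_simps)
qed

text \<open>One copy of each element of \<open>S\<close> is forced; taking these copies away leaves
  a member of \<open>A\<close>.\<close>

lemma has_gf_contains_all:
  assumes f: "has_gf sum_mset A f" and A: "A \<subseteq> parts_in S" and fin: "finite S"
  shows "has_gf sum_mset {L \<in> parts_in S. S \<subseteq> set_mset L \<and> L - mset_set S \<in> A} (fps_X ^ \<Sum>S * f)"
proof (rule has_gf_bij[OF f])
  have sub: "S \<subseteq> set_mset L \<longleftrightarrow> mset_set S \<subseteq># L" for L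
    by (auto simp: subseteq_mset_def count_mset_set' fin subset_iff Suc_le_eq)
  show "bij_betw (\<lambda>L. L + mset_set S) A {L \<in> parts_in S. S \<subseteq> set_mset L \<and> L - mset_set S \<in> A}"
    by (rule bij_betw_byWitness[where f' = "\<lambda>L. L - mset_set S"])
      (use A fin in \<open>auto simp: sub subset_mset.diff_add\<close>, auto simp: subset_iff)
qed (auto simp: sum_unfold_sum_mset)

text \<open>The partition is cut at part size \<open>k\<close>, with \<open>b\<close> parts above
  the cut. The series for \<open>M\<close> and \<open>P_tilde\<close> together will be matched with
  this expansion term by term, the number of large parts being shifted by \<open>k\<close>.\<close>

lemma parts_gf_union_by_size:
  "parts_gf {1..} $ n = (\<Sum>b\<le>n. (fps_X ^ (Suc k * b) * (upto_gf k * upto_gf b)) $ n)"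
proof -
  have U: "{1..k} \<union> {Suc k..} = {1..}" by auto
  have "int (card {L \<in> parts_in {1..}. sum_mset L = n}) = (\<Sum>b\<in>{..n}. (upto_gf k * (fps_X ^ (Suc k * b) * upto_gf b)) $ n)"
  proof (rule has_gf_fibre)
    fix b
    have "has_gf sum_mset {L. set_mset L \<subseteq> {1..k} \<union> {Suc k..} \<and> filter_mset (\<lambda>p. p \<in> {1..k}) L \<in> parts_in {1..k} \<and>
      filter_mset (\<lambda>p. p \<in> {Suc k..}) L \<in> {L. size L = b \<and> set_mset L \<subseteq> {Suc k..}}} (upto_gf k * (fps_X ^ (Suc k * b) * upto_gf b))"
      by (rule has_gf_split[OF has_gf_parts_gf has_gf_size_ge]) auto
    also have "{L. set_mset L \<subseteq> {1..k} \<union> {Suc k..} \<and> filter_mset (\<lambda>p. p \<in> {1..k}) L \<in> parts_in {1..k} \<and>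
      filter_mset (\<lambda>p. p \<in> {Suc k..}) L \<in> {L. size L = b \<and> set_mset L \<subseteq> {Suc k..}}} =
      {L \<in> parts_in {1..}. size (filter_mset (\<lambda>p. k < p) L) = b}"
      unfolding U by (auto simp: Suc_le_eq)
    finally show "has_gf sum_mset {L \<in> parts_in {1..}. size (filter_mset (\<lambda>p. k < p) L) = b} (upto_gf k * (fps_X ^ (Suc k * b) * upto_gf b))" .
  next
    fix L assume "L \<in> parts_in {1..}" "sum_mset L = n"
    moreover from this have "size L \<le> sum_mset L" by (intro size_le_sum_mset) auto
    ultimately show "size (filter_mset (\<lambda>p. k < p) L) \<in> {..n}"
      using le_trans[OF size_filter_mset_lesseq[of "\<lambda>p. k < p" L]] by auto
  qed auto
  thus ?thesis using has_gf_parts_gf[of "{1..}"] by (simp add: has_gf_def algebra_simps)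
qed

subsection \<open>Truncations of the pentagonal number theorem\<close>

lemma Least_missing_iff:
  fixes k :: nat
  assumes "1 \<le> k"
  shows "k = (LEAST i. 0 < i \<and> i \<notin># L) \<longleftrightarrow> {1..k - 1} \<subseteq> set_mset L \<and> k \<notin># L"
proof
  have "infinite {0::nat<..}" by (rule infinite_Ioi)
  hence "\<not> {0<..} \<subseteq> set_mset L" by (metis finite_set_mset finite_subset)
  hence "\<exists>i. 0 < i \<and> i \<notin># L" by (auto simp: subset_iff)
  hence "0 < (LEAST i. 0 < i \<and> i \<notin># L) \<and> (LEAST i. 0 < i \<and> i \<notin># L) \<notin># L" by (rule LeastI_ex)
  moreover assume k: "k = (LEAST i. 0 < i \<and> i \<notin># L)"
  ultimately have "k \<notin># L" by simp
  moreover have "i \<in># L" if "i \<in> {1..k - 1}" for i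
    using not_less_Least[of i "\<lambda>i. 0 < i \<and> i \<notin># L"] that unfolding k[symmetric] by auto
  ultimately show "{1..k - 1} \<subseteq> set_mset L \<and> k \<notin># L" by blast
next
  assume L: "{1..k - 1} \<subseteq> set_mset L \<and> k \<notin># L"
  show "k = (LEAST i. 0 < i \<and> i \<notin># L)"
  proof (rule Least_equality[symmetric])
    fix i assume i: "0 < i \<and> i \<notin># L"
    hence "i \<notin> {1..k - 1}" using L by blast
    thus "k \<le> i" using i by auto
  qed (use L assms in auto)
qed

definition mex_dominated :: "nat \<Rightarrow> nat multiset set" where
  "mex_dominated k = {L \<in> parts_in {1..}. {1..k - 1} \<subseteq> set_mset L \<and> k \<notin># L \<and>
     size {#p \<in># L. p < k#} < size {#p \<in># L. k < p#}}"

text \<open>The condition on the smallest part above \<open>k\<close> is phrased through the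
  filtered multiset, so that it concerns one side of the cut at \<open>k\<close> only.\<close>

definition gap_repeated :: "nat \<Rightarrow> nat multiset set" where
  "gap_repeated k = {L \<in> parts_in {1..}. {1..k} \<subseteq> set_mset L \<and> {#p \<in># L. k < p#} \<noteq> {#} \<and>
     k + 1 \<le> count {#p \<in># L. k < p#} (Min (set_mset {#p \<in># L. k < p#}))}"

lemma M_conv: "1 \<le> k \<Longrightarrow> M k n = card {L \<in> mex_dominated k. sum_mset L = n}"
  unfolding M_def is_partition_def zero_notin_iff mex_dominated_def
  by (subst Least_missing_iff) (auto intro!: arg_cong[where f = card])

lemma P_tilde_conv: "P_tilde k n = card {L \<in> gap_repeated k. sum_mset L = n}"
proof -
  have "count L (Min {p \<in> set_mset L. k < p}) = count {#p \<in># L. k < p#} (Min (set_mset {#p \<in># L. k < p#}))"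
    if "{p \<in> set_mset L. k < p} \<noteq> {}" for L
    using Min_in[OF _ that] by auto
  moreover have "{#p \<in># L. k < p#} \<noteq> {#} \<longleftrightarrow> {p \<in> set_mset L. k < p} \<noteq> {}" for L :: "nat multiset"
    by auto
  ultimately have "{p \<in> set_mset L. k < p} \<noteq> {} \<and> k + 1 \<le> count L (Min {p \<in> set_mset L. k < p}) \<longleftrightarrow>
      {#p \<in># L. k < p#} \<noteq> {#} \<and> k + 1 \<le> count {#p \<in># L. k < p#} (Min (set_mset {#p \<in># L. k < p#}))" for L
    by (simp only: simp_thms cong: conj_cong)
  thus ?thesis
    unfolding P_tilde_def is_partition_def zero_notin_iff gap_repeated_def subset_eq[of "{1..k}"]
    by (intro arg_cong[where f = card] Collect_cong) (simp only: mem_Collect_eq, blast)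
qed

text \<open>Below \<open>k\<close> there is a forced copy of each of 1, ..., \<open>k - 1\<close>,
  and having fewer than \<open>b\<close> parts there means at most \<open>b - k\<close> further
  ones. These are counted by a Gaussian binomial coefficient, whose denominator
  \<open>upto_gf (b - 1)\<close> cancels against \<open>upto_gf b * (1 - fps_X ^ b)\<close> from the
  parts above \<open>k\<close>.\<close>

lemma mex_dominated_gf:
  assumes "1 \<le> k"
  shows "\<exists>f. has_gf sum_mset {L \<in> mex_dominated k. size {#p \<in># L. k < p#} = b} f \<and>
    (if k \<le> b then f * (1 - fps_X ^ b) = fps_X ^ (\<Sum>{1..k-1} + (k + 1) * b) * (upto_gf (k - 1) * upto_gf (b - k)) else f = 0)"
proof (cases "k \<le> b")
  case False
  have sm: "size {#p \<in># L. p < k#} \<ge> k - 1" if "{1..k - 1} \<subseteq> set_mset L" for L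
  proof -
    have "mset_set {1..k-1} \<subseteq># {#p \<in># L. p < k#}"
      using that assms by (auto simp: subseteq_mset_def count_mset_set' subset_iff Suc_le_eq)
    from size_mset_mono[OF this] show ?thesis by simp
  qed
  have "{L \<in> mex_dominated k. size {#p \<in># L. k < p#} = b} = {}"
  proof -
    have "k \<le> size {#p \<in># L. k < p#}" if "L \<in> mex_dominated k" for L
    proof -
      have "{1..k - 1} \<subseteq> set_mset L" "size {#p \<in># L. p < k#} < size {#p \<in># L. k < p#}"
        using that unfolding mex_dominated_def by blast+
      with sm[of L] show ?thesis by linarith
    qed
    thus ?thesis using False by blast
  qed
  thus ?thesis using False has_gf_empty[of sum_mset] by (intro exI[of _ 0]) (simp only: if_False simp_thms)
next
  case True
  let ?A = "{L \<in> parts_in {1..k-1}. size L \<le> b - k}"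
  let ?A' = "{L \<in> parts_in {1..k-1}. {1..k-1} \<subseteq> set_mset L \<and> L - mset_set {1..k-1} \<in> ?A}"
  let ?B = "{L. size L = b \<and> set_mset L \<subseteq> {Suc k..}}"
  obtain g where g: "has_gf sum_mset ?A g"
    using has_gf_subset[OF has_gf_parts_gf[of "{1..k-1}"], of ?A] by auto
  have gb: "g * upto_gf (b - 1) = upto_gf (k - 1) * upto_gf (b - k)"
    using q_binomial[OF g] True assms by simp
  have eb: "upto_gf b * (1 - fps_X ^ b) = upto_gf (b - 1)"
    using upto_gf_Suc[of "b - 1"] True assms by simp
  let ?f = "fps_X ^ \<Sum>{1..k-1} * g * (fps_X ^ (Suc k * b) * upto_gf b)"
  have "has_gf sum_mset {L. set_mset L \<subseteq> {1..k-1} \<union> {Suc k..} \<and> filter_mset (\<lambda>p. p \<in> {1..k-1}) L \<in> ?A' \<and>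
     filter_mset (\<lambda>p. p \<in> {Suc k..}) L \<in> ?B} ?f"
    by (rule has_gf_split[OF has_gf_contains_all[OF g] has_gf_size_ge]) auto
  also have "{L. set_mset L \<subseteq> {1..k-1} \<union> {Suc k..} \<and> filter_mset (\<lambda>p. p \<in> {1..k-1}) L \<in> ?A' \<and>
     filter_mset (\<lambda>p. p \<in> {Suc k..}) L \<in> ?B} = {L \<in> mex_dominated k. size {#p \<in># L. k < p#} = b}"
  proof (rule Collect_cong)
    fix L
    show "(set_mset L \<subseteq> {1..k-1} \<union> {Suc k..} \<and> filter_mset (\<lambda>p. p \<in> {1..k-1}) L \<in> ?A' \<and>
      filter_mset (\<lambda>p. p \<in> {Suc k..}) L \<in> ?B) \<longleftrightarrow> L \<in> mex_dominated k \<and> size {#p \<in># L. k < p#} = b"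
    proof (cases "set_mset L \<subseteq> {1..k-1} \<union> {Suc k..}")
      case L: True
      have fl: "filter_mset (\<lambda>p. p \<in> {1..k-1}) L = {#p \<in># L. p < k#}"
        by (rule filter_mset_cong) (use L assms in auto)
      have fr: "filter_mset (\<lambda>p. p \<in> {Suc k..}) L = {#p \<in># L. k < p#}"
        by (rule filter_mset_cong) auto
      have sz: "size ({#p \<in># L. p < k#} - mset_set {1..k-1}) \<le> b - k \<longleftrightarrow> size {#p \<in># L. p < k#} < b"
        if "{1..k - 1} \<subseteq> set_mset L"
      proof -
        have sub: "mset_set {1..k-1} \<subseteq># {#p \<in># L. p < k#}"
          using that assms by (auto simp: subseteq_mset_def count_mset_set' subset_iff Suc_le_eq)
        have "size ({#p \<in># L. p < k#} - mset_set {1..k-1}) = size {#p \<in># L. p < k#} - (k - 1)"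
          unfolding size_Diff_submset[OF sub] by simp
        thus ?thesis using size_mset_mono[OF sub] True assms by simp linarith
      qed
      have "{1..k-1} \<subseteq> set_mset {#p \<in># L. p < k#} \<longleftrightarrow> {1..k-1} \<subseteq> set_mset L" using assms by auto
      moreover have "set_mset L \<subseteq> {1..}" "k \<notin># L" using L assms by (auto simp: subset_iff)
      moreover have "set_mset {#p \<in># L. p < k#} \<subseteq> {1..k-1}" using L by auto
      moreover have "set_mset ({#p \<in># L. p < k#} - mset_set {1..k-1}) \<subseteq> {1..k-1}"
        using calculation by (meson in_diffD subset_eq)
      moreover have "set_mset {#p \<in># L. k < p#} \<subseteq> {Suc k..}" by auto
      moreover have "size ({#p \<in># L. p < k#} - mset_set {1..k-1}) \<le> b - k \<longleftrightarrow> size {#p \<in># L. p < k#} < size {#p \<in># L. k < p#}"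
        if "{1..k - 1} \<subseteq> set_mset L" "size {#p \<in># L. k < p#} = b"
        using sz[OF that(1)] that(2) by simp
      ultimately show ?thesis
        unfolding fl fr mex_dominated_def mem_Collect_eq using L by argo
    next
      case False
      moreover have "set_mset L \<subseteq> {1..k-1} \<union> {Suc k..}" if "L \<in> mex_dominated k"
      proof
        fix x assume "x \<in># L"
        moreover from this have "1 \<le> x" "x \<noteq> k" using that by (auto simp: mex_dominated_def)
        ultimately show "x \<in> {1..k-1} \<union> {Suc k..}" by auto
      qed
      ultimately show ?thesis by blast
    qed
  qed
  finally have 1: "has_gf sum_mset {L \<in> mex_dominated k. size {#p \<in># L. k < p#} = b} ?f" .
  have "?f * (1 - fps_X ^ b) = fps_X ^ \<Sum>{1..k-1} * fps_X ^ (Suc k * b) * (g * (upto_gf b * (1 - fps_X ^ b)))"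
    by (simp only: ac_simps)
  also have "\<dots> = fps_X ^ (\<Sum>{1..k-1} + (k + 1) * b) * (upto_gf (k - 1) * upto_gf (b - k))"
    unfolding eb gb by (simp add: power_add)
  finally show ?thesis using 1 True by auto
qed

text \<open>The parts up to \<open>k\<close> are free apart from one forced copy of each. The
  \<open>b\<close> parts above \<open>k\<close>, lowered by \<open>k + 1\<close>, fall under
  \<open>min_count_gf\<close> with \<open>c = k + 1\<close>.\<close>

lemma gap_repeated_gf:
  "\<exists>f. has_gf sum_mset {L \<in> gap_repeated k. size {#p \<in># L. k < p#} = b} f \<and>
    (if k < b then f * (1 - fps_X ^ b) = fps_X ^ (\<Sum>{1..k} + (k + 1) * b) * (upto_gf k * upto_gf (b - k - 1)) else f = 0)"
proof (cases "k < b")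
  case False
  have "k + 1 \<le> size {#p \<in># L. k < p#}" if "L \<in> gap_repeated k" for L
    by (rule le_trans[OF _ count_le_size]) (use that in \<open>unfold gap_repeated_def, blast\<close>)
  hence "{L \<in> gap_repeated k. size {#p \<in># L. k < p#} = b} = {}"
    using False by (metis (mono_tags, lifting) Collect_empty_eq Suc_eq_plus1 Suc_le_eq)
  thus ?thesis using False has_gf_empty[of sum_mset] by (intro exI[of _ 0]) (simp only: if_False simp_thms)
next
  case True
  let ?A = "{L \<in> parts_in {1..k}. {1..k} \<subseteq> set_mset L \<and> L - mset_set {1..k} \<in> parts_in {1..k}}"
  let ?W = "{L. size L = b \<and> k + 1 \<le> count L (Min (set_mset L))}"
  let ?B = "{L. size L = b \<and> k + 1 \<le> count L (Min (set_mset L)) \<and> set_mset L \<subseteq> {Suc k..}}"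
  obtain w where w: "has_gf sum_mset ?W w"
    using has_gf_subset[OF has_gf_size[of b], of ?W] by auto
  have w': "w * (1 - fps_X ^ b) = upto_gf (b - k - 1)"
    using min_count_gf[OF w] True by simp
  have "0 < b" using True by simp
  from has_gf_shift[OF w, of b "Suc k", unfolded shift_min_count_image[OF this]]
  have B: "has_gf sum_mset ?B (fps_X ^ (Suc k * b) * w)" by auto
  let ?f = "fps_X ^ \<Sum>{1..k} * upto_gf k * (fps_X ^ (Suc k * b) * w)"
  have "has_gf sum_mset {L. set_mset L \<subseteq> {1..k} \<union> {Suc k..} \<and> filter_mset (\<lambda>p. p \<in> {1..k}) L \<in> ?A \<and>
     filter_mset (\<lambda>p. p \<in> {Suc k..}) L \<in> ?B} ?f"
    by (rule has_gf_split[OF has_gf_contains_all[OF has_gf_parts_gf] B]) auto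
  also have "{L. set_mset L \<subseteq> {1..k} \<union> {Suc k..} \<and> filter_mset (\<lambda>p. p \<in> {1..k}) L \<in> ?A \<and>
     filter_mset (\<lambda>p. p \<in> {Suc k..}) L \<in> ?B} = {L \<in> gap_repeated k. size {#p \<in># L. k < p#} = b}"
  proof (rule Collect_cong)
    fix L
    have fr: "filter_mset (\<lambda>p. p \<in> {Suc k..}) L = {#p \<in># L. k < p#}"
      by (rule filter_mset_cong) auto
    have "{1..k} \<union> {Suc k..} = {1..}" by auto
    moreover have "{1..k} \<subseteq> set_mset (filter_mset (\<lambda>p. p \<in> {1..k}) L) \<longleftrightarrow> {1..k} \<subseteq> set_mset L" by auto
    moreover have "filter_mset (\<lambda>p. p \<in> {1..k}) L \<in> parts_in {1..k}" by auto
    moreover have "filter_mset (\<lambda>p. p \<in> {1..k}) L - mset_set {1..k} \<in> parts_in {1..k}" by (auto dest: in_diffD)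
    moreover have "set_mset {#p \<in># L. k < p#} \<subseteq> {Suc k..}" by auto
    moreover have "size {#p \<in># L. k < p#} = b \<Longrightarrow> {#p \<in># L. k < p#} \<noteq> {#}" using True by (metis size_empty not_less0)
    ultimately show "(set_mset L \<subseteq> {1..k} \<union> {Suc k..} \<and> filter_mset (\<lambda>p. p \<in> {1..k}) L \<in> ?A \<and>
      filter_mset (\<lambda>p. p \<in> {Suc k..}) L \<in> ?B) \<longleftrightarrow> L \<in> gap_repeated k \<and> size {#p \<in># L. k < p#} = b"
      unfolding fr gap_repeated_def mem_Collect_eq by blast
  qed
  finally have 1: "has_gf sum_mset {L \<in> gap_repeated k. size {#p \<in># L. k < p#} = b} ?f" .
  have "?f * (1 - fps_X ^ b) = fps_X ^ \<Sum>{1..k} * fps_X ^ (Suc k * b) * (upto_gf k * (w * (1 - fps_X ^ b)))"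
    by (simp only: ac_simps)
  also have "\<dots> = fps_X ^ (\<Sum>{1..k} + (k + 1) * b) * (upto_gf k * upto_gf (b - k - 1))"
    unfolding w' by (simp add: power_add)
  finally show ?thesis using 1 True by auto
qed

text \<open>For a fixed number \<open>k + s\<close> of parts above \<open>k\<close>, the two series
  times \<open>1 - X^(k + s)\<close> have a common factor, with cofactors \<open>1 - X^k\<close> and
  \<open>X^k (1 - X^s)\<close>. These add up to \<open>1 - X^(k + s)\<close>, which then
  cancels.\<close>

lemma M_plus_P_tilde:
  assumes k: "1 \<le> k"
  defines "K \<equiv> k * (3 * k + 1) div 2"
  shows "int (M k n) + int (P_tilde k n) = (if n < K then 0 else parts_gf {1..} $ (n - K))"
proof -
  obtain f where f: "\<And>b. has_gf sum_mset {L \<in> mex_dominated k. size {#p \<in># L. k < p#} = b} (f b)"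
    and f1: "\<And>b. k \<le> b \<Longrightarrow> f b * (1 - fps_X ^ b) = fps_X ^ (\<Sum>{1..k-1} + (k + 1) * b) * (upto_gf (k - 1) * upto_gf (b - k))"
    and f0: "\<And>b. b < k \<Longrightarrow> f b = 0"
  proof -
    have "\<exists>f. \<forall>b. has_gf sum_mset {L \<in> mex_dominated k. size {#p \<in># L. k < p#} = b} (f b) \<and>
      (if k \<le> b then f b * (1 - fps_X ^ b) = fps_X ^ (\<Sum>{1..k-1} + (k + 1) * b) * (upto_gf (k - 1) * upto_gf (b - k)) else f b = 0)"
      by (intro choice allI mex_dominated_gf k)
    thus ?thesis using that by (meson not_le)
  qed
  obtain g where g: "\<And>b. has_gf sum_mset {L \<in> gap_repeated k. size {#p \<in># L. k < p#} = b} (g b)"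
    and g1: "\<And>b. k < b \<Longrightarrow> g b * (1 - fps_X ^ b) = fps_X ^ (\<Sum>{1..k} + (k + 1) * b) * (upto_gf k * upto_gf (b - k - 1))"
    and g0: "\<And>b. \<not> k < b \<Longrightarrow> g b = 0"
  proof -
    have "\<exists>g. \<forall>b. has_gf sum_mset {L \<in> gap_repeated k. size {#p \<in># L. k < p#} = b} (g b) \<and>
      (if k < b then g b * (1 - fps_X ^ b) = fps_X ^ (\<Sum>{1..k} + (k + 1) * b) * (upto_gf k * upto_gf (b - k - 1)) else g b = 0)"
      by (intro choice allI gap_repeated_gf)
    thus ?thesis using that by meson
  qed
  have T: "\<Sum>{1..k} = \<Sum>{1..k-1} + k"
    using k by (cases k) (auto simp: atLeastAtMostSuc_conv)
  have K: "K = \<Sum>{1..k} + k * k"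
  proof -
    have "2 * \<Sum>{1..k} = k * (k + 1)" by (induction k) auto
    hence "k * (3 * k + 1) = 2 * (\<Sum>{1..k} + k * k)" by (simp add: algebra_simps)
    thus ?thesis unfolding K_def by simp
  qed
  have ek: "upto_gf (k - 1) = upto_gf k * (1 - fps_X ^ k)" using upto_gf_Suc[of "k - 1"] k by simp
  have fg: "f (k + s) + g (k + s) = fps_X ^ K * (fps_X ^ (Suc k * s) * (upto_gf k * upto_gf s))" for s
  proof -
    let ?Y = "fps_X ^ (\<Sum>{1..k-1} + (k + 1) * (k + s)) :: int fps"
    have "g (k + s) * (1 - fps_X ^ (k + s)) = fps_X ^ (\<Sum>{1..k} + (k + 1) * (k + s)) * (upto_gf k * (upto_gf s * (1 - fps_X ^ s)))"
    \<comment> \<open>At \<open>s = 0\<close> both sides vanish: membership in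
      \<open>gap_repeated k\<close> needs at least \<open>k + 1\<close> parts above
      \<open>k\<close>, and \<open>1 - fps_X ^ 0\<close> is 0.\<close>
    proof (cases s)
      case 0
      thus ?thesis using g0[of k] by simp
    next
      case (Suc t)
      thus ?thesis using g1[of "k + s"] upto_gf_Suc[of t] by simp
    qed
    also have "\<dots> = ?Y * fps_X ^ k * (upto_gf k * (upto_gf s * (1 - fps_X ^ s)))"
      unfolding T by (simp add: power_add algebra_simps)
    finally have "(f (k + s) + g (k + s)) * (1 - fps_X ^ (k + s)) =
       ?Y * (upto_gf k * (1 - fps_X ^ k) * upto_gf s) + ?Y * fps_X ^ k * (upto_gf k * (upto_gf s * (1 - fps_X ^ s)))"
      using f1[OF le_add1, of s] by (simp only: distrib_right ek add_diff_cancel_left' mult.assoc)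
    also have "\<dots> = ?Y * (upto_gf k * upto_gf s) * (1 - fps_X ^ k * fps_X ^ s)"
      by algebra
    finally have "f (k + s) + g (k + s) = ?Y * (upto_gf k * upto_gf s)"
      using one_minus_X_nz[of "k + s"] k by (simp add: power_add)
    also have "?Y = fps_X ^ K * fps_X ^ (Suc k * s)"
      unfolding K T power_add[symmetric] by (simp add: algebra_simps)
    finally show ?thesis by (simp add: mult.assoc)
  qed
  \<comment> \<open>At most \<open>n\<close> parts can occur; the larger bound \<open>k + n\<close>
    is chosen so that \<open>s = b - k\<close> runs exactly over \<open>{..n}\<close>.\<close>
  have "int (M k n) = (\<Sum>b\<in>{..k + n}. f b $ n)"
    unfolding M_conv[OF k]
  proof (rule has_gf_fibre[OF f])
    fix L assume "L \<in> mex_dominated k" "sum_mset L = n"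
    moreover from this have "size L \<le> sum_mset L" by (intro size_le_sum_mset) (auto simp: mex_dominated_def)
    ultimately show "size {#p \<in># L. k < p#} \<in> {..k + n}"
      using le_trans[OF size_filter_mset_lesseq[of "\<lambda>p. k < p" L]] by (auto intro: trans_le_add2)
  qed auto
  moreover have "int (P_tilde k n) = (\<Sum>b\<in>{..k + n}. g b $ n)"
    unfolding P_tilde_conv
  proof (rule has_gf_fibre[OF g])
    fix L assume "L \<in> gap_repeated k" "sum_mset L = n"
    moreover from this have "size L \<le> sum_mset L" by (intro size_le_sum_mset) (auto simp: gap_repeated_def)
    ultimately show "size {#p \<in># L. k < p#} \<in> {..k + n}"
      using le_trans[OF size_filter_mset_lesseq[of "\<lambda>p. k < p" L]] by (auto intro: trans_le_add2)
  qed auto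
  ultimately have "int (M k n) + int (P_tilde k n) = (\<Sum>b\<in>{..k + n}. (f b + g b) $ n)"
    by (simp add: sum.distrib)
  also have "\<dots> = (\<Sum>b\<in>{k..k + n}. (f b + g b) $ n)"
    by (rule sum.mono_neutral_right) (use f0 g0 in auto)
  also have "\<dots> = (\<Sum>s\<in>{..n}. (f (k + s) + g (k + s)) $ n)"
    by (rule sum.reindex_bij_witness[of _ "\<lambda>s. k + s" "\<lambda>b. b - k"]) auto
  also have "\<dots> = (if n < K then 0 else \<Sum>s\<in>{..n}. (fps_X ^ (Suc k * s) * (upto_gf k * upto_gf s)) $ (n - K))"
    unfolding fg by (simp only: fps_X_power_mult_nth split: if_split) simp
  also have "(\<Sum>s\<in>{..n}. (fps_X ^ (Suc k * s) * (upto_gf k * upto_gf s)) $ (n - K)) = (\<Sum>s\<in>{..n - K}. (fps_X ^ (Suc k * s) * (upto_gf k * upto_gf s)) $ (n - K))"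
    by (rule sum.mono_neutral_right) (auto simp: fps_X_power_mult_nth)
  also have "\<dots> = parts_gf {1..} $ (n - K)" by (rule parts_gf_union_by_size[symmetric])
  finally show ?thesis .
qed

subsection \<open>Diagonal sums\<close>

lemma upto_gf_pred: "0 < i \<Longrightarrow> upto_gf (i - 1) = upto_gf i * (1 - fps_X ^ i)"
  using upto_gf_Suc[of "i - 1"] by simp

text \<open>Splitting \<open>1 - X\<^sup>i = (1 - X\<^sup>i\<^sup>-\<^sup>t) + X\<^sup>i\<^sup>-\<^sup>t (1 - X\<^sup>t)\<close> in every summand shows that the
  right-hand side satisfies the same recurrence in \<open>i\<close> as the left-hand side.\<close>

lemma upto_gf_mult:
  "upto_gf i * upto_gf w = (\<Sum>t\<le>min i w. fps_X ^ ((i - t) * (w - t)) * (upto_gf t * upto_gf (i - t) * upto_gf (w - t)))"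
proof -
  \<comment> \<open>Setting the summand to 0 for \<open>t > w\<close> lets the sum run over
    \<open>t \<le> i\<close> throughout the induction on \<open>i\<close>; the bound
    \<open>min i w\<close> is restored at the end.\<close>
  define g where "g = (\<lambda>i t. if t \<le> w then fps_X ^ ((i - t) * (w - t)) * (upto_gf t * upto_gf (i - t) * upto_gf (w - t)) else 0)"
  have ring1: "P * (x * y * z) * (1 - r + r * (1 - s)) = P * (x * (y * (1 - r)) * z) + P * r * ((x * (1 - s)) * y * z)"
    for P x y z r s :: "int fps" by (simp add: algebra_simps)
  have ring2: "P * r * (x * y * z) + P * (x * y * (z * (1 - r))) = P * (x * y * z)"
    for P x y z r :: "int fps" by (simp add: algebra_simps)
  have step: "(\<Sum>t\<le>Suc i. g (Suc i) t) * (1 - fps_X ^ Suc i) = (\<Sum>t\<le>i. g i t)" for i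
  proof -
    \<comment> \<open>\<open>A\<close> comes from the half of the split factor that lowers the index
      \<open>Suc i - t\<close>, and \<open>B\<close> from the half that lowers the index
      \<open>t\<close>. Hence it is \<open>B (Suc t)\<close> that combines with
      \<open>A t\<close>.\<close>
    define A where "A = (\<lambda>t. if t \<le> i \<and> t \<le> w then fps_X ^ ((Suc i - t) * (w - t)) * (upto_gf t * upto_gf (i - t) * upto_gf (w - t)) else 0)"
    define B where "B = (\<lambda>t. if 0 < t \<and> t \<le> w then
       fps_X ^ ((Suc i - t) * (w - t)) * fps_X ^ (Suc i - t) * (upto_gf (t - 1) * upto_gf (Suc i - t) * upto_gf (w - t)) else 0)"
    have AB: "g (Suc i) t * (1 - fps_X ^ Suc i) = A t + B t" if "t \<le> Suc i" for t
    proof (cases "t \<le> w")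
      case True
      have "fps_X ^ Suc i = fps_X ^ (Suc i - t) * (fps_X ^ t :: int fps)"
        using that by (simp flip: power_add)
      hence "1 - fps_X ^ Suc i = (1 - fps_X ^ (Suc i - t)) + fps_X ^ (Suc i - t) * (1 - fps_X ^ t :: int fps)"
        by (simp add: algebra_simps)
      hence "g (Suc i) t * (1 - fps_X ^ Suc i) =
          fps_X ^ ((Suc i - t) * (w - t)) * (upto_gf t * (upto_gf (Suc i - t) * (1 - fps_X ^ (Suc i - t))) * upto_gf (w - t)) +
          fps_X ^ ((Suc i - t) * (w - t)) * fps_X ^ (Suc i - t) * ((upto_gf t * (1 - fps_X ^ t)) * upto_gf (Suc i - t) * upto_gf (w - t))"
        using True unfolding g_def by (simp only: if_True ring1)
      moreover have "upto_gf t * (1 - fps_X ^ t) = (if t = 0 then 0 else upto_gf (t - 1))"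
        using upto_gf_pred[of t] by simp
      moreover have "upto_gf (Suc i - t) * (1 - fps_X ^ (Suc i - t)) = (if t = Suc i then 0 else upto_gf (i - t))"
        using upto_gf_pred[of "Suc i - t"] that by simp
      ultimately show ?thesis using True that unfolding A_def B_def by auto
    qed (simp add: g_def A_def B_def)
    have AB': "A t + B (Suc t) = g i t" if "t \<le> i" for t
    proof (cases "t < w")
      case True
      have "B (Suc t) = fps_X ^ ((i - t) * (w - Suc t)) * fps_X ^ (i - t) * (upto_gf t * upto_gf (i - t) * upto_gf (w - t - 1))"
        using True unfolding B_def by simp
      also have "fps_X ^ ((i - t) * (w - Suc t)) * fps_X ^ (i - t) = (fps_X ^ ((i - t) * (w - t)) :: int fps)"
      proof -
        have "w - t = Suc (w - Suc t)" using True by simp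
        thus ?thesis by (simp add: power_add[symmetric] add.commute)
      qed
      also have "upto_gf (w - t - 1) = upto_gf (w - t) * (1 - fps_X ^ (w - t))"
        using upto_gf_pred[of "w - t"] True by simp
      finally have "B (Suc t) = fps_X ^ ((i - t) * (w - t)) * (upto_gf t * upto_gf (i - t) * (upto_gf (w - t) * (1 - fps_X ^ (w - t))))" .
      moreover have "A t = fps_X ^ ((i - t) * (w - t)) * fps_X ^ (w - t) * (upto_gf t * upto_gf (i - t) * upto_gf (w - t))"
      proof -
        have "(Suc i - t) * (w - t) = (i - t) * (w - t) + (w - t)"
          using that by (simp add: Suc_diff_le)
        thus ?thesis using True that unfolding A_def by (simp only: power_add) simp
      qed
      moreover have "g i t = fps_X ^ ((i - t) * (w - t)) * (upto_gf t * upto_gf (i - t) * upto_gf (w - t))"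
        using True unfolding g_def by simp
      ultimately show ?thesis by (simp only: ring2)
    qed (use that in \<open>auto simp: A_def B_def g_def\<close>)
    have "(\<Sum>t\<le>Suc i. g (Suc i) t) * (1 - fps_X ^ Suc i) = (\<Sum>t\<le>Suc i. A t) + (\<Sum>t\<le>Suc i. B t)"
      unfolding sum_distrib_right sum.distrib[symmetric] by (rule sum.cong[OF refl], rule AB) simp
    also have "(\<Sum>t\<le>Suc i. A t) = (\<Sum>t\<le>i. A t)" by (simp add: A_def)
    also have "(\<Sum>t\<le>Suc i. B t) = (\<Sum>t\<le>i. B (Suc t))"
      unfolding sum.atMost_Suc_shift by (simp add: B_def)
    also have "(\<Sum>t\<le>i. A t) + (\<Sum>t\<le>i. B (Suc t)) = (\<Sum>t\<le>i. g i t)"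
      unfolding sum.distrib[symmetric] by (rule sum.cong[OF refl], rule AB') simp
    finally show ?thesis .
  qed
  have "upto_gf i * upto_gf w = (\<Sum>t\<le>i. g i t)"
  proof (induction i)
    case 0
    show ?case by (simp add: g_def parts_gf_empty)
  next
    case (Suc i)
    have "(\<Sum>t\<le>Suc i. g (Suc i) t) * (1 - fps_X ^ Suc i) = upto_gf (Suc i) * upto_gf w * (1 - fps_X ^ Suc i)"
      unfolding step Suc.IH[symmetric] upto_gf_Suc[of i, symmetric] by (simp only: ac_simps)
    thus ?case using one_minus_X_nz[of "Suc i"] by simp
  qed
  also have "\<dots> = (\<Sum>t\<le>min i w. g i t)"
    by (rule sum.mono_neutral_right) (auto simp: g_def)
  also have "\<dots> = (\<Sum>t\<le>min i w. fps_X ^ ((i - t) * (w - t)) * (upto_gf t * upto_gf (i - t) * upto_gf (w - t)))"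
    by (rule sum.cong) (auto simp: g_def)
  finally show ?thesis .
qed

text \<open>The truncation at \<open>N\<close> replaces infinite sums of power series: it does not affect the
  coefficients up to \<open>N\<close>.\<close>

lemma diagonal_sum:
  fixes R :: "nat \<Rightarrow> nat \<Rightarrow> bool"
  assumes R: "\<And>a b t. R (a + t) (b + t) = R a b" and n: "n \<le> N"
  defines "I \<equiv> {(a, b). a \<le> N \<and> b \<le> N \<and> R a b}"
  shows "(\<Sum>(a, b)\<in>I. fps_X ^ (a + b) * (upto_gf a * upto_gf b)) $ n =
    ((\<Sum>t\<le>N. fps_X ^ (2 * t) * upto_gf t) * (\<Sum>(a, b)\<in>I. fps_X ^ (a + b + a * b) * (upto_gf a * upto_gf b))) $ n"
proof -
  have fin: "finite I" by (rule finite_subset[of _ "{..N} \<times> {..N}"]) (auto simp: I_def)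
  define h where "h = (\<lambda>t a b. fps_X ^ (2 * t) * upto_gf t * (fps_X ^ (a + b + a * b) * (upto_gf a * upto_gf b)))"
  have h: "fps_X ^ (a + b) * (fps_X ^ ((a - t) * (b - t)) * (upto_gf t * upto_gf (a - t) * upto_gf (b - t))) = h t (a - t) (b - t)"
    if t: "t \<le> a" "t \<le> b" for a b t
  proof -
    have "a + b = 2 * t + ((a - t) + (b - t))" using t by simp
    hence "fps_X ^ (a + b) = (fps_X ^ (2 * t) * (fps_X ^ ((a - t) + (b - t))) :: int fps)"
      by (simp only: power_add)
    thus ?thesis unfolding h_def by (simp only: power_add ac_simps)
  qed
  have "(\<Sum>(a, b)\<in>I. fps_X ^ (a + b) * (upto_gf a * upto_gf b)) =
      (\<Sum>(a, b)\<in>I. \<Sum>t\<le>min a b. fps_X ^ (a + b) * (fps_X ^ ((a - t) * (b - t)) * (upto_gf t * upto_gf (a - t) * upto_gf (b - t))))"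
    unfolding sum_distrib_left[symmetric] upto_gf_mult[symmetric] ..
  also have "\<dots> = (\<Sum>p\<in>I. \<Sum>t\<le>min (fst p) (snd p). h t (fst p - t) (snd p - t))"
    by (intro sum.cong refl, clarify, intro sum.cong) (simp_all only: fst_conv snd_conv h atMost_iff min.bounded_iff)
  also have "\<dots> = (\<Sum>(p, t)\<in>Sigma I (\<lambda>p. {..min (fst p) (snd p)}). h t (fst p - t) (snd p - t))"
    by (rule sum.Sigma) (use fin in auto)
  \<comment> \<open>Passing from \<open>(a, b)\<close> to \<open>(a - t, b - t)\<close> preserves
    \<open>R\<close>, while the box of side \<open>N\<close> turns into the bounds on
    \<open>fst p + t\<close> and \<open>snd p + t\<close>.\<close>
  also have "\<dots> = (\<Sum>(t, p)\<in>{(t, p) \<in> {..N} \<times> I. fst p + t \<le> N \<and> snd p + t \<le> N}. h t (fst p) (snd p))"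
    by (rule sum.reindex_bij_witness[of _ "\<lambda>(t, p). ((fst p + t, snd p + t), t)" "\<lambda>(p, t). (t, (fst p - t, snd p - t))"])
      (use R[of _ _ _] in \<open>auto simp: I_def\<close>, metis R le_add_diff_inverse2)
  finally have "(\<Sum>(a, b)\<in>I. fps_X ^ (a + b) * (upto_gf a * upto_gf b)) $ n =
     (\<Sum>(t, p)\<in>{(t, p) \<in> {..N} \<times> I. fst p + t \<le> N \<and> snd p + t \<le> N}. h t (fst p) (snd p) $ n)"
    by (simp add: fps_sum_nth case_prod_beta)
  \<comment> \<open>The terms added here have \<open>a + t\<close> or \<open>b + t\<close> above
    \<open>N\<close>, so their exponent \<open>2 * t + a + b + a * b\<close> exceeds
    \<open>n\<close>. Over the full product of index sets the sum factors.\<close>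
  also have "\<dots> = (\<Sum>(t, p)\<in>{..N} \<times> I. h t (fst p) (snd p) $ n)"
  proof (rule sum.mono_neutral_left)
    have "h t a b $ n = 0" if "\<not> (a + t \<le> N \<and> b + t \<le> N)" for t a b
    proof -
      have "n < 2 * t + (a + b + a * b)" using that n by auto
      moreover have "h t a b = fps_X ^ (2 * t + (a + b + a * b)) * (upto_gf t * (upto_gf a * upto_gf b))"
        unfolding h_def by (simp only: power_add ac_simps)
      ultimately show ?thesis by (simp add: fps_X_power_mult_nth)
    qed
    thus "\<forall>i\<in>{..N} \<times> I - {(t, p) \<in> {..N} \<times> I. fst p + t \<le> N \<and> snd p + t \<le> N}. (case i of (t, p) \<Rightarrow> h t (fst p) (snd p) $ n) = 0"
      by auto
  qed (use fin in auto)
  also have "\<dots> = (\<Sum>(t, p)\<in>{..N} \<times> I. h t (fst p) (snd p)) $ n"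
    by (simp add: fps_sum_nth case_prod_beta)
  also have "(\<Sum>(t, p)\<in>{..N} \<times> I. h t (fst p) (snd p)) =
      (\<Sum>t\<le>N. fps_X ^ (2 * t) * upto_gf t) * (\<Sum>(a, b)\<in>I. fps_X ^ (a + b + a * b) * (upto_gf a * upto_gf b))"
    unfolding sum_product sum.cartesian_product h_def by (simp add: case_prod_beta)
  finally show ?thesis .
qed

section \<open>Finite sums of the series \<open>upto_gf t\<close>\<close>

text \<open>Telescopes, since for positive \<open>t\<close> the summand is
  \<open>upto_gf t - upto_gf (t - 1)\<close>.\<close>

lemma sum_X_upto_gf: "(\<Sum>t\<le>N. fps_X ^ t * upto_gf t) = upto_gf N"
proof (induction N)
  case (Suc N)
  have "upto_gf N + fps_X ^ Suc N * upto_gf (Suc N) = upto_gf (Suc N)"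
    using upto_gf_Suc[of N] by (simp add: algebra_simps)
  with Suc show ?case by simp
qed (simp add: parts_gf_empty)

text \<open>The finite form of the identity that sums \<open>X^(2 t) e_t\<close> to
  \<open>(1 - X) P\<close>; the last summand on the right is invisible in the coefficients up to
  \<open>N\<close>.\<close>

lemma sum_X2_upto_gf: "(\<Sum>t\<le>N. fps_X ^ (2 * t) * upto_gf t) = (1 - fps_X) * upto_gf N + fps_X ^ Suc N * upto_gf N"
proof (induction N)
  case (Suc N)
  have ring: "(1 - x) * (e' * (1 - y)) + y * (e' * (1 - y)) + y * y * e' = (1 - x) * e' + x * y * e'"
    for x y e' :: "int fps" by (simp add: algebra_simps)
  have "fps_X ^ (2 * Suc N) = (fps_X ^ Suc N * fps_X ^ Suc N :: int fps)"
    by (simp only: mult_2 power_add)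
  hence "(\<Sum>t\<le>Suc N. fps_X ^ (2 * t) * upto_gf t) =
      (1 - fps_X) * upto_gf N + fps_X ^ Suc N * upto_gf N + fps_X ^ Suc N * fps_X ^ Suc N * upto_gf (Suc N)"
    by (simp only: sum.atMost_Suc Suc.IH)
  also have "\<dots> = (1 - fps_X) * upto_gf (Suc N) + fps_X * fps_X ^ Suc N * upto_gf (Suc N)"
    unfolding upto_gf_Suc[of N, symmetric] by (rule ring)
  finally show ?case by simp
qed (simp add: parts_gf_empty)

lemma parts_gf_nth: "n \<le> N \<Longrightarrow> parts_gf {1..} $ n = upto_gf N $ n"
proof -
  assume "n \<le> N"
  hence "{L \<in> parts_in {1..}. sum_mset L = n} = {L \<in> parts_in {1..N}. sum_mset L = n}"
    by (auto simp: subset_iff dest: le_sum_mset intro: le_trans)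
  thus ?thesis by (simp add: parts_gf_def)
qed

subsection \<open>Cranks\<close>

text \<open>The crank values counted by \<open>C m\<close>, except for its prescribed value at 1.\<close>

definition crank_range :: "nat \<Rightarrow> int set" where
  "crank_range m = (if m = 0 then {0<..} else if m = 1 then {0..} else {0})"

text \<open>In the crank sum a pair with \<open>b > 0\<close> records the number \<open>b\<close> of
  ones and the number \<open>a\<close> of parts exceeding \<open>b\<close>. The bound
  \<open>N\<close> truncates an infinite family.\<close>

definition index_pairs :: "nat \<Rightarrow> nat \<Rightarrow> (nat \<times> nat) set" where
  "index_pairs m N = {(a, b). a \<le> N \<and> b \<le> N \<and> int a - int b \<in> crank_range m}"

lemma finite_index_pairs: "finite (index_pairs m N)"
  by (rule finite_subset[of _ "{..N} \<times> {..N}"]) (auto simp: index_pairs_def)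

lemma crank_no_ones:
  assumes "L \<in> parts_in {1..}" "count L 1 = 0" "L \<noteq> {#}"
  shows "0 < crank L"
proof -
  have "Max (set_mset L) \<in> set_mset L" using assms by (intro Max_in) auto
  hence "1 \<le> Max (set_mset L)" using assms(1) by (auto simp only: subset_iff mem_Collect_eq atLeast_iff)
  thus ?thesis using assms by (simp add: crank_def)
qed

lemma crank_ones:
  assumes "0 < count L 1"
  shows "crank L = int (size {#p \<in># L. count L 1 < p#}) - int (count L 1)"
proof -
  have "L \<noteq> {#}" using assms by auto
  moreover have "count L 1 \<noteq> 0" using assms by linarith
  ultimately show ?thesis by (simp only: crank_def Let_def if_False)
qed

text \<open>Once the \<open>w\<close> ones are fixed, the remaining parts up to \<open>w\<close> lie
  in \<open>{2..w}\<close>, and \<open>parts_gf {2..w}\<close> is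
  \<open>(1 - fps_X) * upto_gf w\<close>; this is where the factor \<open>1 - fps_X\<close> arises.
  The \<open>i\<close> larger parts are at least \<open>w + 1\<close>, which gives the mixed
  exponent \<open>i * w\<close>.\<close>

lemma has_gf_ones_and_large:
  assumes w: "1 \<le> w"
  shows "has_gf sum_mset {L \<in> parts_in {1..}. count L 1 = w \<and> size {#p \<in># L. w < p#} = i}
    ((1 - fps_X) * (fps_X ^ (i + w + i * w) * (upto_gf i * upto_gf w)))"
proof -
  have "{1..w} = insert 1 {2..w}" using w by auto
  hence ew: "upto_gf w * (1 - fps_X) = parts_gf {2..w}"
    using parts_gf_insert[of 1 "{2..w}"] by simp
  let ?A = "{L \<in> parts_in {1..w}. count L 1 = w}"
  let ?B = "{L. size L = i \<and> set_mset L \<subseteq> {Suc w..}}"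
  have bij: "bij_betw (\<lambda>L. L + replicate_mset w 1) (parts_in {2..w}) ?A"
  proof (rule bij_betw_byWitness[where f' = "\<lambda>L. filter_mset (\<lambda>p. p \<noteq> 1) L"])
    show "\<forall>L\<in>parts_in {2..w}. filter_mset (\<lambda>p. p \<noteq> 1) (L + replicate_mset w 1) = L"
    proof
      fix L assume "L \<in> parts_in {2..w}"
      hence "count L 1 = 0" by (auto simp: count_eq_zero_iff)
      thus "filter_mset (\<lambda>p. p \<noteq> 1) (L + replicate_mset w 1) = L"
        by (intro multiset_eqI) auto
    qed
    show "\<forall>L\<in>?A. filter_mset (\<lambda>p. p \<noteq> 1) L + replicate_mset w 1 = L"
      by (auto intro!: multiset_eqI)
    show "(\<lambda>L. L + replicate_mset w 1) ` parts_in {2..w} \<subseteq> ?A"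
    proof safe
      fix L x assume L: "set_mset L \<subseteq> {2..w}"
      hence "count L 1 = 0" by (auto simp: count_eq_zero_iff)
      thus "count (L + replicate_mset w 1) 1 = w" by simp
      assume "x \<in># L + replicate_mset w 1"
      thus "x \<in> {1..w}" using L w by (auto split: if_splits)
    qed
    show "filter_mset (\<lambda>p. p \<noteq> 1) ` ?A \<subseteq> parts_in {2..w}"
      by (auto simp: subset_iff)
  qed
  have A: "has_gf sum_mset ?A (fps_X ^ w * parts_gf {2..w})"
    by (rule has_gf_bij[OF has_gf_parts_gf bij]) auto
  have "has_gf sum_mset {L. set_mset L \<subseteq> {1..w} \<union> {Suc w..} \<and> filter_mset (\<lambda>p. p \<in> {1..w}) L \<in> ?A \<and>
     filter_mset (\<lambda>p. p \<in> {Suc w..}) L \<in> ?B} (fps_X ^ w * parts_gf {2..w} * (fps_X ^ (Suc w * i) * upto_gf i))"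
    by (rule has_gf_split[OF A has_gf_size_ge]) auto
  also have "{L. set_mset L \<subseteq> {1..w} \<union> {Suc w..} \<and> filter_mset (\<lambda>p. p \<in> {1..w}) L \<in> ?A \<and>
     filter_mset (\<lambda>p. p \<in> {Suc w..}) L \<in> ?B} = {L \<in> parts_in {1..}. count L 1 = w \<and> size {#p \<in># L. w < p#} = i}"
  proof -
    have "{1..w} \<union> {Suc w..} = {1..}" by auto
    moreover have "filter_mset (\<lambda>p. p \<in> {Suc w..}) L = {#p \<in># L. w < p#}" for L :: "nat multiset"
      by (rule filter_mset_cong) auto
    moreover have "count (filter_mset (\<lambda>p. p \<in> {1..w}) L) 1 = count L 1" for L using w by simp
    moreover have "set_mset (filter_mset (\<lambda>p. p \<in> {1..w}) L) \<subseteq> {1..w}" for L by auto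
    moreover have "set_mset {#p \<in># L. w < p#} \<subseteq> {Suc w..}" for L :: "nat multiset" by auto
    ultimately show ?thesis by (intro Collect_cong) (simp only: mem_Collect_eq, blast)
  qed
  also have "fps_X ^ w * parts_gf {2..w} * (fps_X ^ (Suc w * i) * upto_gf i) =
      (1 - fps_X) * (fps_X ^ (w + Suc w * i) * (upto_gf i * upto_gf w))"
    unfolding ew[symmetric] power_add by (simp only: ac_simps)
  also have "w + Suc w * i = i + w + i * w" by simp
  finally show ?thesis .
qed

text \<open>In the presence of \<open>w\<close> ones the crank is \<open>i - w\<close>, so the
  preceding count applies. Without ones the crank is 0 for the empty partition and positive
  otherwise. As \<open>crank_range m\<close> contains all positive integers or none, membership of 1
  decides for all of these.\<close>

lemma card_crank:
  assumes "j \<le> N"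
  shows "int (card {L. is_partition j L \<and> crank L \<in> crank_range m}) =
    ((if 0 \<in> crank_range m then 1 else 0) + (if 1 \<in> crank_range m then parts_gf {2..} - 1 else 0)) $ j +
    ((1 - fps_X) * (\<Sum>(a, b)\<in>{(a, b) \<in> index_pairs m N. 0 < b}. fps_X ^ (a + b + a * b) * (upto_gf a * upto_gf b))) $ j"
proof -
  define A where "A = {L \<in> parts_in {1..}. crank L \<in> crank_range m}"
  \<comment> \<open>The label \<open>(0, 0)\<close> collects all partitions without ones, whatever
    their parts. It lies outside \<open>I\<close>, where the second component is positive.\<close>
  define g where "g = (\<lambda>L :: nat multiset. let w = count L 1 in if w = 0 then (0, 0) else (size {#p \<in># L. w < p#}, w))"
  define I where "I = {(a, b) \<in> index_pairs m N. 0 < b}"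
  define f where "f = (\<lambda>(i, w). if w = 0 then (if 0 \<in> crank_range m then 1 else 0) + (if 1 \<in> crank_range m then parts_gf {2..} - 1 else 0)
     else (1 - fps_X) * (fps_X ^ (i + w + i * w) * (upto_gf i * upto_gf w)))"
  have finI: "finite I" unfolding I_def by (rule finite_subset[OF _ finite_index_pairs[of m N]]) auto
  have A0: "has_gf sum_mset {L \<in> A. g L = (0, 0)} (f (0, 0))"
  proof -
    have no1: "count L 1 = 0 \<longleftrightarrow> L \<in> parts_in {2..}" if "L \<in> parts_in {1..}" for L :: "nat multiset"
    proof
      assume "count L 1 = 0"
      hence "1 \<notin># L" by (simp add: not_in_iff)
      hence "x \<in> {2..}" if "x \<in># L" for x using that \<open>L \<in> parts_in {1..}\<close> by (cases "x = 1") auto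
      thus "L \<in> parts_in {2..}" by blast
    qed (auto simp: count_eq_zero_iff)
    have pos: "0 < crank L" if "L \<in> parts_in {2..}" "L \<noteq> {#}" for L :: "nat multiset"
    proof (rule crank_no_ones)
      show "L \<in> parts_in {1..}" using that by auto
      thus "count L 1 = 0" using no1 that by blast
    qed fact
    have in_pos: "c \<in> crank_range m \<longleftrightarrow> 1 \<in> crank_range m" if "0 < c" for c
      using that by (auto simp: crank_range_def)
    have g0: "g L = (0, 0) \<longleftrightarrow> count L 1 = 0" for L
      by (simp only: g_def Let_def prod.inject split: if_split) blast
    have crank0: "crank {#} = 0" by (simp add: crank_def)
    have "{L \<in> A. g L = (0, 0)} = {L \<in> {{#}}. 0 \<in> crank_range m} \<union> {L \<in> parts_in {2..} - {{#}}. 1 \<in> crank_range m}" (is "?l = ?r")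
    proof (intro equalityI subsetI)
      fix L assume "L \<in> ?l"
      hence L: "L \<in> parts_in {2..}" "crank L \<in> crank_range m" using no1[of L] by (auto simp: A_def g0)
      show "L \<in> ?r"
      proof (cases "L = {#}")
        case False
        thus ?thesis using L pos[of L] in_pos by blast
      qed (use L crank0 in auto)
    next
      fix L assume L: "L \<in> ?r"
      hence "L \<in> parts_in {2..}" by auto
      moreover from this have "L \<in> parts_in {1..}" by auto
      moreover have "crank L \<in> crank_range m"
      proof (cases "L = {#}")
        case False
        thus ?thesis using L pos[of L] in_pos by blast
      qed (use L crank0 in auto)
      ultimately show "L \<in> ?l" using no1 unfolding A_def g0 by blast
    qed
    moreover have "has_gf sum_mset {L \<in> {{#}}. 0 \<in> crank_range m} (if 0 \<in> crank_range m then 1 else 0)"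
      using has_gf_singleton[of sum_mset "{#}"] has_gf_empty by auto
    moreover have "has_gf sum_mset {L \<in> parts_in {2..} - {{#}}. 1 \<in> crank_range m} (if 1 \<in> crank_range m then parts_gf {2..} - 1 else 0)"
    proof (cases "1 \<in> crank_range m")
      case True
      obtain h where h: "has_gf sum_mset (parts_in {2..} - {{#}}) h"
        using has_gf_subset[OF has_gf_parts_gf[of "{2..}"], of "parts_in {2..} - {{#}}"] by auto
      have "has_gf sum_mset ({{#}} \<union> (parts_in {2..} - {{#}})) (fps_X ^ sum_mset {#} + h)"
        by (rule has_gf_disj_Un[OF has_gf_singleton h]) auto
      moreover have "{{#}} \<union> (parts_in {2..} - {{#}}) = parts_in {2..}" by auto
      ultimately have "parts_gf {2..} = 1 + h" using has_gf_unique[OF has_gf_parts_gf[of "{2..}"]] by simp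
      hence "parts_gf {2..} - 1 = h" by simp
      moreover have "{L \<in> parts_in {2..} - {{#}}. 1 \<in> crank_range m} = parts_in {2..} - {{#}}"
        using True by blast
      ultimately show ?thesis using h True by (simp only: if_True)
    qed (use has_gf_empty in auto)
    moreover have "{L \<in> {{#}}. 0 \<in> crank_range m} \<inter> {L \<in> parts_in {2..} - {{#}}. 1 \<in> crank_range m} = {}"
      by blast
    ultimately show ?thesis
      unfolding f_def by (simp only: prod.case refl if_True) (rule has_gf_disj_Un)
  qed
  have Aiw: "has_gf sum_mset {L \<in> A. g L = (i, w)} (f (i, w))" if "(i, w) \<in> I" for i w
  proof -
    have w: "1 \<le> w" "int i - int w \<in> crank_range m" using that by (auto simp: I_def index_pairs_def)
    have "{L \<in> A. g L = (i, w)} = {L \<in> parts_in {1..}. count L 1 = w \<and> size {#p \<in># L. w < p#} = i}"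
      using w by (auto simp: A_def g_def Let_def crank_ones)
    with has_gf_ones_and_large[OF w(1), of i] w(1) show ?thesis by (simp add: f_def)
  qed
  have "int (card {L \<in> A. sum_mset L = j}) = (\<Sum>p\<in>insert (0, 0) I. f p $ j)"
  proof (rule has_gf_fibre)
    fix p assume "p \<in> insert (0, 0) I"
    thus "has_gf sum_mset {L \<in> A. g L = p} (f p)" using A0 Aiw by (cases p) auto
  next
    fix L assume L: "L \<in> A" "sum_mset L = j"
    hence "size L \<le> j" using size_le_sum_mset[of L] by (auto simp: A_def)
    hence "size {#p \<in># L. count L 1 < p#} \<le> N" "count L 1 \<le> N"
      using assms size_filter_mset_lesseq[of "\<lambda>p. count L 1 < p" L] count_le_size[of L 1] by linarith+
    thus "g L \<in> insert (0, 0) I"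
      using L crank_ones[of L] by (auto simp: g_def Let_def A_def I_def index_pairs_def)
  qed (use finI in auto)
  also have "\<dots> = f (0, 0) $ j + (\<Sum>p\<in>I. f p) $ j"
    using finI by (subst sum.insert) (auto simp: I_def fps_sum_nth)
  also have "(\<Sum>p\<in>I. f p) = (1 - fps_X) * (\<Sum>(a, b)\<in>I. fps_X ^ (a + b + a * b) * (upto_gf a * upto_gf b))"
    unfolding sum_distrib_left by (rule sum.cong) (auto simp: f_def I_def)
  also have "{L \<in> A. sum_mset L = j} = {L. is_partition j L \<and> crank L \<in> crank_range m}"
    unfolding A_def is_partition_def zero_notin_iff by auto
  finally show ?thesis unfolding I_def f_def by simp
qed

subsection \<open>Unimodal compositions\<close>

lemma count_mset_eq_count_list: "count (mset xs) x = count_list xs x"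
  by (induction xs) auto

lemma sorted_dropWhile_ge: "sorted xs \<Longrightarrow> x \<in> set (dropWhile (\<lambda>x. x < N) xs) \<Longrightarrow> N \<le> (x :: 'a :: linorder)"
  by (induction xs) (auto split: if_splits)

text \<open>The entry at the peak position \<open>t\<close> is the maximum, but it need not be its
  first occurrence. Between the first occurrence and the peak the list is constant, so the cut can
  be moved back to the first occurrence.\<close>

lemma unimodal_split:
  assumes "unimodal xs" and N: "N = Max (set xs)"
  shows "xs \<noteq> []" "sorted (takeWhile (\<lambda>x. x < N) xs)" "sorted_wrt (\<ge>) (dropWhile (\<lambda>x. x < N) xs)"
proof -
  obtain t where t: "1 \<le> t" "t \<le> length xs" "sorted (take t xs)" "sorted_wrt (\<ge>) (drop (t - 1) xs)"
    using assms unfolding unimodal_def by auto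
  show "xs \<noteq> []" using t by auto
  define ys y zs where "ys = take (t - 1) xs" and "y = xs ! (t - 1)" and "zs = drop t xs"
  have d: "drop (t - 1) xs = y # zs"
    using t unfolding y_def zs_def by (metis Cons_nth_drop_Suc One_nat_def Suc_diff_le Suc_le_lessD diff_Suc_1 diff_Suc_less le_trans less_le_trans not_le Suc_pred)
  have xs: "xs = ys @ y # zs" using append_take_drop_id[of "t - 1" xs] unfolding d ys_def by simp
  have "take t xs = ys @ [y]"
    using t unfolding ys_def y_def by (metis One_nat_def Suc_pred less_eq_Suc_le take_Suc_conv_app_nth)
  with t have ys: "sorted ys" "\<forall>x\<in>set ys. x \<le> y" by (auto simp: sorted_append)
  from t d have zs: "sorted_wrt (\<ge>) zs" "\<forall>x\<in>set zs. x \<le> y" by auto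
  have y: "y = N" unfolding N
    by (rule Max_eqI[symmetric]) (use xs ys zs in auto)
  have "takeWhile (\<lambda>x. x < N) xs = takeWhile (\<lambda>x. x < N) ys"
    unfolding xs y by (induction ys) auto
  thus "sorted (takeWhile (\<lambda>x. x < N) xs)" using ys sorted_takeWhile by metis
  have "dropWhile (\<lambda>x. x < N) xs = dropWhile (\<lambda>x. x < N) ys @ y # zs"
    unfolding xs y by (induction ys) auto
  moreover have eq: "x = N" if "x \<in> set (dropWhile (\<lambda>x. x < N) ys)" for x
    using sorted_dropWhile_ge[OF ys(1) that] ys(2) set_dropWhileD[OF that] y by fastforce
  moreover have "dropWhile (\<lambda>x. x < N) ys = replicate (length (dropWhile (\<lambda>x. x < N) ys)) N"
    using eq by (intro replicate_eqI) auto
  hence "sorted_wrt (\<ge>) (dropWhile (\<lambda>x. x < N) ys)"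
    by (metis sorted_replicate sorted_wrt_rev rev_replicate)
  ultimately show "sorted_wrt (\<ge>) (dropWhile (\<lambda>x. x < N) xs)"
    using zs y by (auto simp: sorted_wrt_append)
qed

text \<open>\<open>Max\<close> is never applied to the empty set here, since \<open>unimodal\<close>
  demands a peak position.\<close>

definition unimodal_with_max :: "nat \<Rightarrow> nat list set" where
  "unimodal_with_max N = {xs. (\<forall>x\<in>set xs. 0 < x) \<and> unimodal xs \<and> Max (set xs) = N}"

text \<open>Cutting before the first occurrence of the maximum makes the decomposition unique.\<close>

lemma has_gf_unimodal_with_max:
  assumes N: "0 < N"
    and f: "has_gf sum_mset {B \<in> parts_in {1..N}. N \<in># B \<and> Q (count B N)} f"
  shows "has_gf sum_list {xs \<in> unimodal_with_max N. Q (count_list xs N)} (upto_gf (N - 1) * f)"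
proof -
  let ?A = "parts_in {1..N - 1}"
  let ?B = "{B \<in> parts_in {1..N}. N \<in># B \<and> Q (count B N)}"
  let ?U = "{xs \<in> unimodal_with_max N. Q (count_list xs N)}"
  \<comment> \<open>\<open>A\<close> holds the entries before the first maximum and \<open>B\<close>
    the rest. The order within each piece is prescribed, and \<open>N \<in># B\<close> puts the
    maximum at the head of the second piece.\<close>
  let ?F = "\<lambda>(A, B). sorted_list_of_multiset A @ rev (sorted_list_of_multiset B)"
  let ?G = "\<lambda>xs. (mset (takeWhile (\<lambda>x. x < N) xs), mset (dropWhile (\<lambda>x. x < N) xs))"
  have A: "has_gf sum_mset ?A (upto_gf (N - 1))" by (rule has_gf_parts_gf) simp
  have F: "?F (A, B) \<in> ?U \<and> ?G (?F (A, B)) = (A, B)" if AB: "A \<in> ?A" "B \<in> ?B" for A B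
  proof -
    define ys where "ys = sorted_list_of_multiset A"
    define rs where "rs = rev (sorted_list_of_multiset B)"
    have ys: "sorted ys" "mset ys = A" by (simp_all add: ys_def)
    have rs: "sorted_wrt (\<ge>) rs" "mset rs = B" by (simp_all add: rs_def sorted_wrt_rev)
    have sys: "set ys \<subseteq> {1..N - 1}" using AB ys by auto
    have srs: "set rs \<subseteq> {1..N}" "N \<in> set rs" using AB rs by auto
    obtain r zs where r: "rs = r # zs" using srs by (cases rs) auto
    have "r = N" using rs(1) srs r by fastforce
    hence rN: "rs = N # zs" using r by simp
    have lt: "\<forall>x\<in>set ys. x < N" using sys N by (force simp: subset_iff)
    have tw: "takeWhile (\<lambda>x. x < N) (ys @ rs) = ys" "dropWhile (\<lambda>x. x < N) (ys @ rs) = rs"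
      using lt unfolding rN by (induction ys) auto
    have "unimodal (ys @ rs)"
      unfolding unimodal_def
    proof (intro bexI[of _ "Suc (length ys)"] conjI)
      show "sorted_wrt (\<le>) (take (Suc (length ys)) (ys @ rs))"
        using ys lt unfolding rN by (auto simp: sorted_append less_imp_le)
      show "sorted_wrt (\<ge>) (drop (Suc (length ys) - 1) (ys @ rs))" using rs by simp
    qed (simp add: rN)
    moreover have "Max (set (ys @ rs)) = N"
      by (rule Max_eqI) (use lt srs in \<open>auto simp: less_imp_le\<close>)
    moreover have "count_list (ys @ rs) N = count B N"
    proof -
      have "N \<notin> set ys" using lt by auto
      thus ?thesis using rs(2) by (auto simp: count_list_0_iff count_mset_eq_count_list)
    qed
    ultimately have "ys @ rs \<in> ?U"
      using AB sys srs by (auto simp: unimodal_with_max_def)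
    thus ?thesis using tw ys rs by (simp add: ys_def rs_def)
  qed
  have G: "?G xs \<in> ?A \<times> ?B \<and> ?F (?G xs) = xs" if xs: "xs \<in> ?U" for xs
  proof -
    define ys where "ys = takeWhile (\<lambda>x. x < N) xs"
    define rs where "rs = dropWhile (\<lambda>x. x < N) xs"
    have u: "unimodal xs" "N = Max (set xs)" "\<forall>x\<in>set xs. 0 < x" "Q (count_list xs N)"
      using xs by (auto simp: unimodal_with_max_def)
    note sp = unimodal_split[OF u(1,2)]
    have app: "xs = ys @ rs" by (simp add: ys_def rs_def)
    have N_in: "N \<in> set xs" using sp(1) u(2) by simp
    have le: "\<forall>x\<in>set xs. x \<le> N" using u(2) by simp
    have lt: "\<forall>x\<in>set ys. x < N" unfolding ys_def using set_takeWhileD by metis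
    have "set ys \<subseteq> {1..N - 1}"
    proof
      fix x assume "x \<in> set ys"
      hence "x < N" "0 < x" using lt u(3) app by auto
      thus "x \<in> {1..N - 1}" by auto
    qed
    moreover have "set rs \<subseteq> {1..N}"
    proof
      fix x assume "x \<in> set rs"
      hence "x \<le> N" "0 < x" using le u(3) app by auto
      thus "x \<in> {1..N}" by auto
    qed
    moreover have "N \<in> set rs" using N_in lt app by auto
    moreover have "count (mset rs) N = count_list xs N"
    proof -
      have "N \<notin> set ys" using lt by auto
      thus ?thesis unfolding app by (auto simp: count_list_0_iff count_mset_eq_count_list)
    qed
    moreover have "sorted_list_of_multiset (mset ys) = ys"
      using sp(2) by (simp add: ys_def sorted_sort_id)
    moreover have "rev (sorted_list_of_multiset (mset rs)) = rs"
    proof -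
      have "sorted (rev rs)" using sp(3) by (simp add: rs_def sorted_wrt_rev)
      hence "sorted_list_of_multiset (mset (rev rs)) = rev rs"
        unfolding sorted_list_of_multiset_mset by (rule sorted_sort_id)
      thus ?thesis by simp
    qed
    ultimately show ?thesis using u(4) app unfolding ys_def[symmetric] rs_def[symmetric] by auto
  qed
  have "bij_betw ?F (?A \<times> ?B) ?U"
    by (rule bij_betw_byWitness[where f' = ?G]) (use F G in blast)+
  moreover have "sum_list (?F p) = (\<lambda>(x, y). sum_mset x + sum_mset y) p" for p
    by (cases p) (simp flip: sum_mset_sum_list)
  ultimately show ?thesis by (intro has_gf_bij0[OF has_gf_prod[OF A f]]) auto
qed

text \<open>Removing the \<open>m\<close> copies of \<open>N\<close> leaves parts below
  \<open>N\<close> on both sides, hence the square.\<close>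

lemma has_gf_unimodal_count:
  assumes N: "0 < N" and m: "0 < m"
  shows "has_gf sum_list {xs \<in> unimodal_with_max N. count_list xs N = m} (fps_X ^ (m * N) * (upto_gf (N - 1) * upto_gf (N - 1)))"
proof -
  have bij: "bij_betw (\<lambda>L. L + replicate_mset m N) (parts_in {1..N - 1}) {B \<in> parts_in {1..N}. N \<in># B \<and> count B N = m}"
  proof (rule bij_betw_byWitness[where f' = "filter_mset (\<lambda>p. p \<noteq> N)"])
    have c: "count L N = 0" if "set_mset L \<subseteq> {1..N - 1}" for L
      using that N by (auto simp: count_eq_zero_iff)
    show "\<forall>L\<in>parts_in {1..N - 1}. filter_mset (\<lambda>p. p \<noteq> N) (L + replicate_mset m N) = L"
      using c by (auto intro!: multiset_eqI)
    show "\<forall>B\<in>{B \<in> parts_in {1..N}. N \<in># B \<and> count B N = m}. filter_mset (\<lambda>p. p \<noteq> N) B + replicate_mset m N = B"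
      by (auto intro!: multiset_eqI)
    show "(\<lambda>L. L + replicate_mset m N) ` parts_in {1..N - 1} \<subseteq> {B \<in> parts_in {1..N}. N \<in># B \<and> count B N = m}"
    proof safe
      fix L x assume L: "set_mset L \<subseteq> {1..N - 1}"
      show "count (L + replicate_mset m N) N = m" using c[OF L] by simp
      show "N \<in># L + replicate_mset m N" using m by simp
      assume "x \<in># L + replicate_mset m N"
      hence "x \<in># L \<or> x = N" by (auto split: if_splits)
      moreover have "x \<in># L \<Longrightarrow> x \<in> {1..N - 1}" using L by blast
      ultimately show "x \<in> {1..N}" using N by auto
    qed
    show "filter_mset (\<lambda>p. p \<noteq> N) ` {B \<in> parts_in {1..N}. N \<in># B \<and> count B N = m} \<subseteq> parts_in {1..N - 1}"
    proof safe
      fix B x assume "set_mset B \<subseteq> {1..N}" "x \<in># filter_mset (\<lambda>p. p \<noteq> N) B"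
      hence "x \<in> {1..N}" "x \<noteq> N" by auto
      thus "x \<in> {1..N - 1}" by auto
    qed
  qed
  have "has_gf sum_mset {B \<in> parts_in {1..N}. N \<in># B \<and> count B N = m} (fps_X ^ (m * N) * upto_gf (N - 1))"
    by (rule has_gf_bij[OF has_gf_parts_gf bij]) auto
  from has_gf_unimodal_with_max[OF N this] show ?thesis by (simp only: ac_simps)
qed

lemma has_gf_unimodal:
  assumes N: "0 < N"
  shows "has_gf sum_list (unimodal_with_max N) (fps_X ^ N * (upto_gf (N - 1) * upto_gf N))"
proof -
  have "has_gf sum_mset {B \<in> parts_in {1..N}. N \<in># B \<and> True} (fps_X ^ N * upto_gf N)"
    using has_gf_parts_gf_contains[of N "{1..N}"] N by simp
  from has_gf_unimodal_with_max[OF N this] show ?thesis by (simp add: mult.left_commute)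
qed

lemma Max_composition:
  assumes "is_composition n xs" "unimodal xs"
  shows "Max (set xs) \<in> {1..n}" "xs \<in> unimodal_with_max (Max (set xs))"
proof -
  have "xs \<noteq> []" using unimodal_split(1)[OF assms(2)] by simp
  hence "Max (set xs) \<in> set xs" by simp
  with assms(1) show "Max (set xs) \<in> {1..n}"
    using member_le_sum_list[of "Max (set xs)" xs] by (auto simp: is_composition_def Suc_le_eq)
  show "xs \<in> unimodal_with_max (Max (set xs))"
    using assms by (simp add: unimodal_with_max_def is_composition_def)
qed

lemma u_0: "int (u 0 n) = (\<Sum>N\<in>{1..n}. fps_X ^ N * (upto_gf (N - 1) * upto_gf N)) $ n"
proof -
  define A where "A = {xs. (\<forall>x\<in>set xs. 0 < x) \<and> unimodal xs}"
  have "int (card {xs \<in> A. sum_list xs = n}) = (\<Sum>N\<in>{1..n}. (fps_X ^ N * (upto_gf (N - 1) * upto_gf N)) $ n)"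
  proof (rule has_gf_fibre[where g = "\<lambda>xs. Max (set xs)"])
    fix N assume "N \<in> {1..n}"
    moreover have "{xs \<in> A. Max (set xs) = N} = unimodal_with_max N" by (auto simp: A_def unimodal_with_max_def)
    ultimately show "has_gf sum_list {xs \<in> A. Max (set xs) = N} (fps_X ^ N * (upto_gf (N - 1) * upto_gf N))"
      using has_gf_unimodal[of N] by simp
  qed (use Max_composition in \<open>auto simp: A_def is_composition_def\<close>)
  moreover have "{xs \<in> A. sum_list xs = n} = {xs. is_composition n xs \<and> unimodal xs}"
    by (auto simp: A_def is_composition_def)
  ultimately show ?thesis by (simp add: u_def fps_sum_nth)
qed

lemma u_pos:
  assumes m: "0 < m"
  shows "int (u m n) = (\<Sum>a\<le>n. fps_X ^ (m * a) * (upto_gf a * upto_gf a)) $ n"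
proof -
  define A where "A = {xs. (\<forall>x\<in>set xs. 0 < x) \<and> unimodal xs \<and> count_list xs (Max (set xs)) = m}"
  have "int (card {xs \<in> A. sum_list xs = n + m}) = (\<Sum>N\<in>{1..n + m}. (fps_X ^ (m * N) * (upto_gf (N - 1) * upto_gf (N - 1))) $ (n + m))"
  proof (rule has_gf_fibre[where g = "\<lambda>xs. Max (set xs)"])
    fix N assume "N \<in> {1..n + m}"
    moreover have "{xs \<in> A. Max (set xs) = N} = {xs \<in> unimodal_with_max N. count_list xs N = m}"
      by (auto simp: A_def unimodal_with_max_def)
    ultimately show "has_gf sum_list {xs \<in> A. Max (set xs) = N} (fps_X ^ (m * N) * (upto_gf (N - 1) * upto_gf (N - 1)))"
      using has_gf_unimodal_count[of N m] m by simp
  next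
    fix xs assume "xs \<in> A" "sum_list xs = n + m"
    thus "Max (set xs) \<in> {1..n + m}"
      by (intro Max_composition) (simp_all add: A_def is_composition_def)
  qed simp
  also have "{xs \<in> A. sum_list xs = n + m} = {xs. is_composition (n + m) xs \<and> unimodal xs \<and> count_list xs (Max (set xs)) = m}"
    by (auto simp: A_def is_composition_def)
  \<comment> \<open>With \<open>N = a + 1\<close>, the factor \<open>fps_X ^ m\<close> split off
    from \<open>fps_X ^ (m * N)\<close> absorbs the extra \<open>m\<close> in the total
    \<open>n + m\<close>.\<close>
  also have "(\<Sum>N\<in>{1..n + m}. (fps_X ^ (m * N) * (upto_gf (N - 1) * upto_gf (N - 1))) $ (n + m)) =
      (\<Sum>a<n + m. (fps_X ^ (m * Suc a) * (upto_gf a * upto_gf a)) $ (n + m))"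
    by (rule sum.reindex_bij_witness[of _ Suc "\<lambda>N. N - 1"]) auto
  also have "\<dots> = (\<Sum>a<n + m. (fps_X ^ (m * a) * (upto_gf a * upto_gf a)) $ n)"
  proof (rule sum.cong)
    fix a
    have "fps_X ^ (m * Suc a) * (upto_gf a * upto_gf a) = fps_X ^ m * (fps_X ^ (m * a) * (upto_gf a * upto_gf a))"
      by (simp only: mult_Suc_right power_add mult.assoc)
    thus "(fps_X ^ (m * Suc a) * (upto_gf a * upto_gf a)) $ (n + m) = (fps_X ^ (m * a) * (upto_gf a * upto_gf a)) $ n"
      by (simp only: fps_X_power_mult_nth) simp
  qed simp
  also have "\<dots> = (\<Sum>a\<le>n. (fps_X ^ (m * a) * (upto_gf a * upto_gf a)) $ n)"
  proof (rule sum.mono_neutral_right)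
    show "\<forall>a\<in>{..<n + m} - {..n}. (fps_X ^ (m * a) * (upto_gf a * upto_gf a)) $ n = 0"
    proof
      fix a assume "a \<in> {..<n + m} - {..n}"
      hence "n < a" by simp
      also have "a \<le> m * a" using m by simp
      finally have "n < m * a" .
      thus "(fps_X ^ (m * a) * (upto_gf a * upto_gf a)) $ n = 0" by (simp add: fps_X_power_mult_nth)
    qed
  qed (use m in auto)
  finally show ?thesis using m by (simp add: u_def fps_sum_nth)
qed

subsection \<open>The convolution formula\<close>

text \<open>The sum over \<open>b\<close> is carried out first: by \<open>sum_X_upto_gf\<close> it
  is \<open>upto_gf (a - 1)\<close> for \<open>b < a\<close> and \<open>upto_gf a\<close> for
  \<open>b \<le> a\<close>, and it is a single term for \<open>b = a\<close>. This produces the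
  summands of \<open>u_0\<close> and \<open>u_pos\<close>.\<close>

lemma u_eq_diagonal_sum:
  assumes "m \<in> {0, 1, 2}"
  shows "int (u m n) = (\<Sum>(a, b)\<in>index_pairs m n. fps_X ^ (a + b) * (upto_gf a * upto_gf b)) $ n"
proof -
  have S: "(\<Sum>(a, b)\<in>Sigma {..n} B. fps_X ^ (a + b) * (upto_gf a * upto_gf b)) = (\<Sum>a\<le>n. fps_X ^ a * upto_gf a * (\<Sum>b\<in>B a. fps_X ^ b * upto_gf b))"
    if "\<And>a. finite (B a)" for B :: "nat \<Rightarrow> nat set"
    by (subst sum.Sigma[symmetric]) (use that in \<open>auto simp: sum_distrib_left power_add ac_simps intro!: sum.cong\<close>)
  consider "m = 0" | "m = 1" | "m = 2" using assms by auto
  thus ?thesis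
  proof cases
    case 1
    have I: "index_pairs m n = Sigma {..n} (\<lambda>a. {..<a})"
      using 1 by (auto simp: index_pairs_def crank_range_def)
    have "(\<Sum>(a, b)\<in>index_pairs m n. fps_X ^ (a + b) * (upto_gf a * upto_gf b)) = (\<Sum>a\<in>{..n}. fps_X ^ a * upto_gf a * (\<Sum>b<a. fps_X ^ b * upto_gf b))"
      unfolding I by (rule S) simp
    also have "\<dots> = (\<Sum>a\<in>{1..n}. fps_X ^ a * upto_gf a * (\<Sum>b<a. fps_X ^ b * upto_gf b))"
      by (rule sum.mono_neutral_right) (auto simp: not_le)
    also have "\<dots> = (\<Sum>a\<in>{1..n}. fps_X ^ a * (upto_gf (a - 1) * upto_gf a))"
    proof (rule sum.cong)
      fix a assume "a \<in> {1..n}"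
      hence "{..<a} = {..a - 1}" by auto
      thus "fps_X ^ a * upto_gf a * (\<Sum>b<a. fps_X ^ b * upto_gf b) = fps_X ^ a * (upto_gf (a - 1) * upto_gf a)"
        by (simp only: sum_X_upto_gf ac_simps)
    qed simp
    finally show ?thesis using 1 by (simp only: u_0)
  next
    case 2
    have I: "index_pairs m n = Sigma {..n} (\<lambda>a. {..a})"
      using 2 by (auto simp: index_pairs_def crank_range_def)
    have "(\<Sum>(a, b)\<in>index_pairs m n. fps_X ^ (a + b) * (upto_gf a * upto_gf b)) = (\<Sum>a\<le>n. fps_X ^ a * upto_gf a * (\<Sum>b\<le>a. fps_X ^ b * upto_gf b))"
      unfolding I by (rule S) simp
    also have "\<dots> = (\<Sum>a\<le>n. fps_X ^ (m * a) * (upto_gf a * upto_gf a))"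
      unfolding sum_X_upto_gf 2 by (simp only: mult.assoc mult_1)
    finally show ?thesis using u_pos[of m n] 2 by simp
  next
    case 3
    have I: "index_pairs m n = Sigma {..n} (\<lambda>a. {a})"
      using 3 by (auto simp: index_pairs_def crank_range_def)
    have "(\<Sum>(a, b)\<in>index_pairs m n. fps_X ^ (a + b) * (upto_gf a * upto_gf b)) = (\<Sum>a\<le>n. fps_X ^ a * upto_gf a * (\<Sum>b\<in>{a}. fps_X ^ b * upto_gf b))"
      unfolding I by (rule S) simp
    also have "\<dots> = (\<Sum>a\<le>n. fps_X ^ (m * a) * (upto_gf a * upto_gf a))"
      by (intro sum.cong refl) (simp add: 3 mult_2 power_add mult.assoc mult.left_commute)
    finally show ?thesis using u_pos[of m n] 3 by simp
  qed
qed

lemma no_crank_at_1: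
  assumes "is_partition 1 L"
  shows "crank L = -1"
proof -
  have L: "0 \<notin># L" "sum_mset L = 1" using assms by (auto simp: is_partition_def)
  then obtain x L' where x: "L = add_mset x L'" by (cases L) auto
  have "x = 1" "sum_mset L' = 0" using L unfolding x by (cases x; simp)+
  moreover have "size L' \<le> sum_mset L'" using L x by (intro size_le_sum_mset) auto
  hence "L' = {#}" using \<open>sum_mset L' = 0\<close> by (metis le_zero_eq size_eq_0_iff_empty)
  ultimately show ?thesis by (simp add: x crank_def)
qed

text \<open>The only partition of 1 has crank -1, outside all three ranges, so at 1 the count is 0
  and the prescribed value appears in full as the correction.\<close>

lemma C_conv:
  assumes "m \<in> {0, 1, 2}"
  shows "C m (int j) = int (card {L. is_partition j L \<and> crank L \<in> crank_range m}) +
    (if j = 1 then (if m = 0 then 1 else if m = 1 then 0 else -1) else 0)"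
proof (cases "j = 1")
  case True
  have "{L. is_partition j L \<and> crank L \<in> crank_range m} = {}"
    using True no_crank_at_1 by (auto simp: crank_range_def)
  thus ?thesis using True assms by (auto simp: C_def C0_def C1_def C2_def simp del: Collect_empty_eq)
next
  case False
  thus ?thesis using assms by (auto simp: C_def C0_def C1_def C2_def crank_range_def)
qed

lemma parts_gf_from_2: "(1 - fps_X) * parts_gf {1..} = parts_gf {2..}"
proof -
  have "{1::nat..} = insert 1 {2..}" by auto
  thus ?thesis using parts_gf_insert[of 1 "{2..}"] by (simp add: mult.commute)
qed

lemma mult_nth_cong:
  assumes "\<And>i. i \<le> n \<Longrightarrow> f $ i = g $ i"
  shows "(f * h) $ n = (g * h) $ n"
  unfolding fps_mult_nth using assms by (intro sum.cong) auto

text \<open>The terms with \<open>b > 0\<close> are those of \<open>card_crank\<close>. The terms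
  with \<open>b = 0\<close> form \<open>D\<close> and stand in for the partitions without ones: up
  to degree \<open>N\<close>, \<open>(1 - fps_X) * D\<close> differs from the series of the latter
  by \<open>X\<close>, 0 and \<open>-X\<close> for \<open>m\<close> equal to 0, 1 and 2, which is
  the correction in \<open>C_conv\<close>.\<close>

lemma C_eq_crank_sum:
  assumes m: "m \<in> {0, 1, 2}" and j: "j \<le> N"
  shows "C m (int j) = ((1 - fps_X) * (\<Sum>(a, b)\<in>index_pairs m N. fps_X ^ (a + b + a * b) * (upto_gf a * upto_gf b))) $ j"
proof -
  define G where "G = (\<Sum>(a, b)\<in>{(a, b) \<in> index_pairs m N. 0 < b}. fps_X ^ (a + b + a * b) * (upto_gf a * upto_gf b))"
  define D where "D = (\<Sum>a\<in>{a. a \<le> N \<and> int a \<in> crank_range m}. fps_X ^ a * upto_gf a)"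
  have split: "index_pairs m N = (\<lambda>a. (a, 0)) ` {a. a \<le> N \<and> int a \<in> crank_range m} \<union> {(a, b) \<in> index_pairs m N. 0 < b}"
    by (auto simp: index_pairs_def image_iff)
  have "(\<Sum>(a, b)\<in>index_pairs m N. fps_X ^ (a + b + a * b) * (upto_gf a * upto_gf b)) =
     (\<Sum>(a, b)\<in>(\<lambda>a. (a, 0)) ` {a. a \<le> N \<and> int a \<in> crank_range m}. fps_X ^ (a + b + a * b) * (upto_gf a * upto_gf b)) + G"
    unfolding G_def
    by (subst split, rule sum.union_disjoint)
      (auto intro: finite_subset[OF _ finite_index_pairs[of m N]])
  also have "(\<Sum>(a, b)\<in>(\<lambda>a. (a, 0)) ` {a. a \<le> N \<and> int a \<in> crank_range m}. fps_X ^ (a + b + a * b) * (upto_gf a * upto_gf b)) = D"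
    unfolding D_def by (subst sum.reindex) (auto simp: inj_on_def parts_gf_empty)
  finally have DG: "(\<Sum>(a, b)\<in>index_pairs m N. fps_X ^ (a + b + a * b) * (upto_gf a * upto_gf b)) = D + G" .
  have E2: "((1 - fps_X) * upto_gf N) $ j = parts_gf {2..} $ j"
    using mult_nth_cong[of j "upto_gf N" "parts_gf {1..}" "1 - fps_X"] parts_gf_nth[of _ N] j
    unfolding parts_gf_from_2[symmetric] by (simp add: mult.commute)
  have "((1 - fps_X) * D) $ j =
    ((if 0 \<in> crank_range m then 1 else 0) + (if 1 \<in> crank_range m then parts_gf {2..} - 1 else 0)) $ j +
    (if j = 1 then (if m = 0 then 1 else if m = 1 then 0 else -1) else 0)"
  proof -
    consider "m = 0" | "m = 1" | "m = 2" using m by auto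
    thus ?thesis
    proof cases
      case 1
      have "{a. a \<le> N \<and> int a \<in> crank_range m} = {..N} - {0}"
        using 1 by (auto simp: crank_range_def)
      hence "D = (\<Sum>a\<in>{..N} - {0}. fps_X ^ a * upto_gf a)" by (simp only: D_def)
      also have "\<dots> = upto_gf N - 1"
        by (subst sum_diff1) (auto simp only: finite_atMost sum_X_upto_gf, simp_all add: parts_gf_empty)
      finally have D: "D = upto_gf N - 1" .
      have "(1 - fps_X) * D = (1 - fps_X) * upto_gf N - 1 + fps_X" unfolding D by (simp add: algebra_simps)
      thus ?thesis using 1 E2 by (simp add: crank_range_def)
    next
      case 2
      have "{a. a \<le> N \<and> int a \<in> crank_range m} = {..N}"
        using 2 by (auto simp: crank_range_def)
      hence "D = upto_gf N" by (simp only: D_def sum_X_upto_gf)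
      thus ?thesis using 2 E2 by (simp add: crank_range_def)
    next
      case 3
      have "{a. a \<le> N \<and> int a \<in> crank_range m} = {0}"
        using 3 by (auto simp: crank_range_def)
      hence "D = 1" by (simp add: D_def parts_gf_empty)
      thus ?thesis using 3 by (simp add: crank_range_def)
    qed
  qed
  thus ?thesis
    unfolding DG C_conv[OF m] card_crank[OF j] G_def[symmetric] by (simp only: distrib_left fps_add_nth)
qed

lemma u_eq_convolution:
  assumes m: "m \<in> {0, 1, 2}"
  shows "int (u m n) = (\<Sum>i\<le>n. parts_gf {1..} $ i * C m (int (n - i)))"
proof -
  define G where "G = (\<Sum>(a, b)\<in>index_pairs m n. fps_X ^ (a + b + a * b) * (upto_gf a * upto_gf b))"
  have "int (u m n) = ((\<Sum>t\<le>n. fps_X ^ (2 * t) * upto_gf t) * G) $ n"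
    unfolding u_eq_diagonal_sum[OF m] index_pairs_def G_def
    by (rule diagonal_sum) auto
  \<comment> \<open>Only the coefficients up to \<open>n\<close> of the first factor enter, and
    there the remainder in \<open>sum_X2_upto_gf\<close> vanishes.\<close>
  also have "\<dots> = (((1 - fps_X) * parts_gf {1..}) * G) $ n"
  proof (rule mult_nth_cong)
    fix i assume i: "i \<le> n"
    have "((1 - fps_X) * upto_gf n) $ i = ((1 - fps_X) * parts_gf {1..}) $ i"
      using mult_nth_cong[of i "upto_gf n" "parts_gf {1..}" "1 - fps_X"] parts_gf_nth[of _ n] i by (simp add: mult.commute)
    moreover have "(fps_X ^ Suc n * upto_gf n) $ i = 0" using i unfolding fps_X_power_mult_nth by simp
    ultimately show "(\<Sum>t\<le>n. fps_X ^ (2 * t) * upto_gf t) $ i = ((1 - fps_X) * parts_gf {1..}) $ i"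
      unfolding sum_X2_upto_gf fps_add_nth by simp
  qed
  also have "((1 - fps_X) * parts_gf {1..}) * G = parts_gf {1..} * ((1 - fps_X) * G)" by (simp only: ac_simps)
  also have "\<dots> $ n = (\<Sum>i\<le>n. parts_gf {1..} $ i * C m (int (n - i)))"
    unfolding fps_mult_nth[of "parts_gf {1..}"] G_def atMost_atLeast0
    by (intro sum.cong refl) (simp only: C_eq_crank_sum[OF m diff_le_self])
  finally show ?thesis .
qed

theorem corollary1p7:
  fixes k n m :: nat
  assumes "1 \<le> k" and "1 \<le> n" and "m \<in> {0, 1, 2}"
  shows "(\<lambda>j::nat. C m (int n + int (k * (3 * k + 1) div 2) - int j) * (int (M k j) + int (P_tilde k j)))
           sums int (u m n)"
proof -
  define K where "K = k * (3 * k + 1) div 2"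
  have MP: "int (M k j) + int (P_tilde k j) = (if j < K then 0 else parts_gf {1..} $ (j - K))" for j
    unfolding K_def by (rule M_plus_P_tilde[OF assms(1)])
  let ?f = "\<lambda>j. C m (int n + int K - int j) * (if j < K then 0 else parts_gf {1..} $ (j - K))"
  \<comment> \<open>The support is finite: for \<open>j < K\<close> the second factor is 0, and for
    \<open>j > n + K\<close> the argument of \<open>C m\<close> is negative.\<close>
  have "?f sums (\<Sum>j\<in>{K..n + K}. ?f j)"
    by (rule sums_finite) (auto simp: C_def C0_def C1_def C2_def)
  also have "(\<Sum>j\<in>{K..n + K}. ?f j) = (\<Sum>i\<le>n. parts_gf {1..} $ i * C m (int (n - i)))"
    by (rule sum.reindex_bij_witness[of _ "\<lambda>i. i + K" "\<lambda>j. j - K"]) (auto simp: of_nat_diff)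
  finally show ?thesis
    unfolding MP K_def[symmetric] u_eq_convolution[OF assms(3), symmetric] .
qed

end
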